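(* For each $n$, let $\sigma_{n+1}$ be a uniformly random permutation of $\mathfrak{S}_{n+1}$. Then the random continuous functions $t\mapsto \frac{1}{\sqrt n}f_{\sigma_{n+1}}(nt)$, $t\in[0,1]$, converge in distribution (in $\mathcal{C}([0,1],\mathbb{R})$ with the uniform norm) to $\frac{1}{\sqrt3}\mathcal{B}$, where $\mathcal{B}$ is a standard Brownian motion on $[0,1]$.
   Context: For $\sigma\in\mathfrak{S}_{n+1}$ (written as a word $\sigma(1)\cdots\sigma(n+1)$), $i\in\{1,\dots,n\}$ is a descent of $\sigma$ if $\sigma(i+1)<\sigma(i)$. $f_\sigma:[0,n]\to\mathbb{R}$ is the piecewise linear function with $f_\sigma(0)=0$, linear on each $[i-1,i]$, and $f_\sigma(i)-f_\sigma(i-1)=-1$ if $i$ is a descent of $\sigma$ and $+1$ otherwise. *)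

theory Defs
  imports "HOL-Probability.Probability" "HOL-Combinatorics.Permutations"
begin

definition is_descent :: "(nat \<Rightarrow> nat) \<Rightarrow> nat \<Rightarrow> bool" where
  "is_descent \<sigma> i \<longleftrightarrow> \<sigma> (Suc i) < \<sigma> i"

definition step :: "(nat \<Rightarrow> nat) \<Rightarrow> nat \<Rightarrow> real" where
  "step \<sigma> i = (if is_descent \<sigma> i then -1 else 1)"

text \<open>The piecewise linear function f_sigma on [0,n]: f(0)=0, linear on each [i-1,i],
  with increment step i on [i-1,i]. (Defined on all reals; only [0,n] is used.)\<close>
definition f_perm :: "nat \<Rightarrow> (nat \<Rightarrow> nat) \<Rightarrow> real \<Rightarrow> real" where
  "f_perm n \<sigma> x = (\<Sum>i=1..n. step \<sigma> i * max 0 (min 1 (x - real (i - 1))))"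

definition standard_BM_01 :: "'a measure \<Rightarrow> ('a \<Rightarrow> real \<Rightarrow> real) \<Rightarrow> bool" where
  "standard_BM_01 M B \<longleftrightarrow> prob_space M \<and>
     (\<forall>\<omega>\<in>space M. B \<omega> 0 = 0 \<and> continuous_on {0..1} (B \<omega>)) \<and>
     (\<forall>s t. 0 \<le> s \<and> s < t \<and> t \<le> 1 \<longrightarrow>
        distributed M lborel (\<lambda>\<omega>. B \<omega> t - B \<omega> s) (\<lambda>x. ennreal (normal_density 0 (sqrt (t - s)) x))) \<and>
     (\<forall>(k::nat) (ts::nat \<Rightarrow> real). ts 0 \<ge> 0 \<and> ts k \<le> 1 \<and> (\<forall>i<k. ts i < ts (Suc i)) \<longrightarrow>
        prob_space.indep_vars M (\<lambda>_. borel) (\<lambda>i \<omega>. B \<omega> (ts (Suc i)) - B \<omega> (ts i)) {..<k})"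

definition bounded_continuous_functional_C01 :: "((real \<Rightarrow> real) \<Rightarrow> real) \<Rightarrow> bool" where
  "bounded_continuous_functional_C01 F \<longleftrightarrow>
     (\<exists>K. \<forall>g. continuous_on {0..1} g \<longrightarrow> \<bar>F g\<bar> \<le> K) \<and>
     (\<forall>g. continuous_on {0..1} g \<longrightarrow> (\<forall>\<epsilon>>0. \<exists>\<delta>>0. \<forall>h. continuous_on {0..1} h \<and>
         (SUP t\<in>{0..1}. \<bar>h t - g t\<bar>) < \<delta> \<longrightarrow> \<bar>F h - F g\<bar> < \<epsilon>))"

end

theory Submission
  imports Defs
begin

text \<open>
  Let $U_1, U_2, \dots$ be independent and uniform on $[0,1]$. The fractional parts $V_i$ of
  $U_1 + \dots + U_i$ are again independent and uniform, so their ranks form a uniform permutation,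
  which has a descent at $i$ exactly when the integer part jumps from $U_1 + \dots + U_i$ to
  $U_1 + \dots + U_{i+1}$. Hence the first $k$ positions contain $\lfloor U_1 + \dots + U_{k+1} \rfloor$
  descents, jointly in $k$, and $f_\sigma(k)$ differs by at most 2 from $\sum_{i \le k} (1 - 2 U_i)$, a
  random walk with centered steps of variance $1/3$.

  It remains to prove Donsker's theorem for this walk. It suffices to test Lipschitz functionals,
  since a bounded continuous functional is the increasing limit of its Lipschitz envelopes. The walk is
  compared with its linear interpolation over $m$ blocks. For fixed $m$ the independent block
  increments converge by the central limit theorem, which Skorohod's theorem turns into pointwise
  convergence on a product space; the interpolation error is small uniformly in large $n$ by
  Ottaviani's inequality. Letting $m \to \infty$, the interpolations of the Brownian path converge
  uniformly.
\<close>

section \<open>Convergence in distribution of random paths\<close>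

definition sup_dist :: "(real \<Rightarrow> real) \<Rightarrow> (real \<Rightarrow> real) \<Rightarrow> real" where
  "sup_dist g h = (SUP t\<in>{0..1}. \<bar>g t - h t\<bar>)"

lemma sup_dist_self [simp]: "sup_dist g g = 0"
  by (simp add: sup_dist_def)

lemma sup_dist_commute: "sup_dist g h = sup_dist h g"
  by (simp add: sup_dist_def abs_minus_commute)

lemma sup_dist_least: "(\<And>t. t \<in> {0..1} \<Longrightarrow> \<bar>g t - h t\<bar> \<le> d) \<Longrightarrow> sup_dist g h \<le> d"
  unfolding sup_dist_def by (rule cSUP_least) auto

lemma abs_diff_le_sup_dist:
  assumes "continuous_on {0..1} g" "continuous_on {0..1} h" "t \<in> {0..1}"
  shows "\<bar>g t - h t\<bar> \<le> sup_dist g h"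
  unfolding sup_dist_def
proof (rule cSUP_upper[OF assms(3)])
  show "bdd_above ((\<lambda>t. \<bar>g t - h t\<bar>) ` {0..1})"
    by (intro bounded_imp_bdd_above compact_imp_bounded compact_continuous_image
        continuous_on_rabs continuous_on_diff assms) auto
qed

lemma sup_dist_nonneg:
  assumes "continuous_on {0..1} g" "continuous_on {0..1} h"
  shows "0 \<le> sup_dist g h"
  using abs_diff_le_sup_dist[OF assms, of 0] by auto

lemma sup_dist_triangle:
  assumes "continuous_on {0..1} f" "continuous_on {0..1} g" "continuous_on {0..1} h"
  shows "sup_dist f h \<le> sup_dist f g + sup_dist g h"
proof (rule sup_dist_least)
  fix t :: real assume "t \<in> {0..1}"
  with abs_diff_le_sup_dist[OF assms(1,2) this] abs_diff_le_sup_dist[OF assms(2,3) this]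
  show "\<bar>f t - h t\<bar> \<le> sup_dist f g + sup_dist g h" by linarith
qed

lemma sup_dist_tendsto_0:
  assumes "continuous_on {0..1} g" "\<And>x. continuous_on {0..1} (h x)"
    and "eventually (\<lambda>x. sup_dist (h x) g \<le> d x) A" "(d \<longlongrightarrow> 0) A"
  shows "((\<lambda>x. sup_dist (h x) g) \<longlongrightarrow> 0) A"
  by (intro tendsto_sandwich[OF _ assms(3) tendsto_const assms(4)] always_eventually allI
      sup_dist_nonneg assms(1,2))

lemma bounded_continuous_functional_C01_bounded:
  assumes "bounded_continuous_functional_C01 F"
  obtains C where "\<And>g. continuous_on {0..1} g \<Longrightarrow> \<bar>F g\<bar> \<le> C"
  using assms unfolding bounded_continuous_functional_C01_def by blast

lemma bounded_continuous_functional_C01_continuous: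
  assumes "bounded_continuous_functional_C01 F" "continuous_on {0..1} g" "e > 0"
  obtains \<delta> where "\<delta> > 0" "\<And>h. continuous_on {0..1} h \<Longrightarrow> sup_dist h g < \<delta> \<Longrightarrow> \<bar>F h - F g\<bar> < e"
  using assms unfolding bounded_continuous_functional_C01_def sup_dist_def by meson

lemma bounded_continuous_functional_C01_uminus:
  "bounded_continuous_functional_C01 F \<Longrightarrow> bounded_continuous_functional_C01 (\<lambda>g. - F g)"
  by (auto simp: bounded_continuous_functional_C01_def abs_minus_commute)

lemma bounded_continuous_functional_C01_tendsto:
  assumes F: "bounded_continuous_functional_C01 F"
    and g: "continuous_on {0..1} g" and h: "\<And>x. continuous_on {0..1} (h x)"
    and lim: "((\<lambda>x. sup_dist (h x) g) \<longlongrightarrow> 0) A"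
  shows "((\<lambda>x. F (h x)) \<longlongrightarrow> F g) A"
proof (rule tendstoI)
  fix e :: real assume "e > 0"
  obtain \<delta> where \<delta>: "\<delta> > 0"
    "\<And>h. continuous_on {0..1} h \<Longrightarrow> sup_dist h g < \<delta> \<Longrightarrow> \<bar>F h - F g\<bar> < e"
    using bounded_continuous_functional_C01_continuous[OF F g \<open>e > 0\<close>] by blast
  have "eventually (\<lambda>x. sup_dist (h x) g < \<delta>) A"
    using lim \<delta>(1) by (rule order_tendstoD)
  then show "eventually (\<lambda>x. dist (F (h x)) (F g) < e) A"
    by eventually_elim (simp add: dist_real_def \<delta>(2) h)
qed

definition bounded_lipschitz_functional_C01 :: "real \<Rightarrow> real \<Rightarrow> ((real \<Rightarrow> real) \<Rightarrow> real) \<Rightarrow> bool" where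
  "bounded_lipschitz_functional_C01 C K F \<longleftrightarrow> K \<ge> 0 \<and>
     (\<forall>g. continuous_on {0..1} g \<longrightarrow> \<bar>F g\<bar> \<le> C) \<and>
     (\<forall>g h. continuous_on {0..1} g \<longrightarrow> continuous_on {0..1} h \<longrightarrow> \<bar>F g - F h\<bar> \<le> K * sup_dist g h)"

lemma bounded_lipschitz_functional_C01D:
  assumes "bounded_lipschitz_functional_C01 C K F"
  shows "K \<ge> 0" "\<And>g. continuous_on {0..1} g \<Longrightarrow> \<bar>F g\<bar> \<le> C"
    "\<And>g h. continuous_on {0..1} g \<Longrightarrow> continuous_on {0..1} h \<Longrightarrow> \<bar>F g - F h\<bar> \<le> K * sup_dist g h"
  using assms by (auto simp: bounded_lipschitz_functional_C01_def)

lemma bounded_lipschitz_functional_C01_bound_nonneg: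
  "bounded_lipschitz_functional_C01 C K F \<Longrightarrow> C \<ge> 0"
  using bounded_lipschitz_functional_C01D(2)[of C K F "\<lambda>_. 0"] by fastforce

lemma bounded_lipschitz_imp_bounded_continuous:
  assumes "bounded_lipschitz_functional_C01 C K F"
  shows "bounded_continuous_functional_C01 F"
  unfolding bounded_continuous_functional_C01_def sup_dist_def[symmetric]
proof (intro conjI allI impI)
  note F = bounded_lipschitz_functional_C01D[OF assms]
  show "\<exists>C. \<forall>g. continuous_on {0..1} g \<longrightarrow> \<bar>F g\<bar> \<le> C"
    using F(2) by blast
  fix g :: "real \<Rightarrow> real" and e :: real
  assume g: "continuous_on {0..1} g" and e: "e > 0"
  have "\<bar>F h - F g\<bar> < e" if "continuous_on {0..1} h" "sup_dist h g < e / (K + 1)" for h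
  proof -
    have "\<bar>F h - F g\<bar> \<le> K * sup_dist h g" using that g by (intro F(3))
    also have "\<dots> \<le> K * (e / (K + 1))" using that F(1) by (intro mult_left_mono) auto
    also have "\<dots> < e" using F(1) e by (simp add: field_simps)
    finally show ?thesis .
  qed
  then show "\<exists>\<delta>>0. \<forall>h. continuous_on {0..1} h \<and> sup_dist h g < \<delta> \<longrightarrow> \<bar>F h - F g\<bar> < e"
    using F(1) e by (intro exI[of _ "e / (K + 1)"]) auto
qed

definition lipschitz_envelope :: "((real \<Rightarrow> real) \<Rightarrow> real) \<Rightarrow> real \<Rightarrow> (real \<Rightarrow> real) \<Rightarrow> real" where
  "lipschitz_envelope F k g = (INF h\<in>{h. continuous_on {0..1} h}. F h + k * sup_dist g h)"

context
  fixes F :: "(real \<Rightarrow> real) \<Rightarrow> real" and C :: real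
  assumes F_bounded: "\<And>g. continuous_on {0..1} g \<Longrightarrow> \<bar>F g\<bar> \<le> C"
begin

lemma lipschitz_envelope_lower:
  assumes "continuous_on {0..1} g" "continuous_on {0..1} h" "k \<ge> 0"
  shows "lipschitz_envelope F k g \<le> F h + k * sup_dist g h"
  unfolding lipschitz_envelope_def
proof (rule cINF_lower)
  show "bdd_below ((\<lambda>h. F h + k * sup_dist g h) ` {h. continuous_on {0..1} h})"
  proof (rule bdd_belowI2)
    fix h :: "real \<Rightarrow> real" assume "h \<in> {h. continuous_on {0..1} h}"
    then have "\<bar>F h\<bar> \<le> C" "0 \<le> k * sup_dist g h"
      using assms by (auto intro!: F_bounded mult_nonneg_nonneg sup_dist_nonneg)
    then show "- C \<le> F h + k * sup_dist g h" by linarith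
  qed
qed (use assms in simp)

lemma lipschitz_envelope_greatest:
  assumes "\<And>h. continuous_on {0..1} h \<Longrightarrow> x \<le> F h + k * sup_dist g h"
  shows "x \<le> lipschitz_envelope F k g"
  unfolding lipschitz_envelope_def
proof (rule cINF_greatest)
  show "{h :: real \<Rightarrow> real. continuous_on {0..1} h} \<noteq> {}"
    using continuous_on_const[of "{0..1}" "0::real"] by blast
qed (use assms in simp)

lemma lipschitz_envelope_le:
  "continuous_on {0..1} g \<Longrightarrow> k \<ge> 0 \<Longrightarrow> lipschitz_envelope F k g \<le> F g"
  using lipschitz_envelope_lower[of g g k] by simp

lemma bounded_lipschitz_lipschitz_envelope:
  assumes k: "k \<ge> 0"
  shows "bounded_lipschitz_functional_C01 C k (lipschitz_envelope F k)"
proof -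
  have diff: "lipschitz_envelope F k g - k * sup_dist g h \<le> lipschitz_envelope F k h"
    if "continuous_on {0..1} g" "continuous_on {0..1} h" for g h
  proof (rule lipschitz_envelope_greatest)
    fix f :: "real \<Rightarrow> real" assume f: "continuous_on {0..1} f"
    have "k * sup_dist g f \<le> k * (sup_dist g h + sup_dist h f)"
      using k f that by (intro mult_left_mono sup_dist_triangle)
    with lipschitz_envelope_lower[OF that(1) f k]
    show "lipschitz_envelope F k g - k * sup_dist g h \<le> F f + k * sup_dist h f"
      by (simp add: algebra_simps)
  qed
  have "\<bar>lipschitz_envelope F k g\<bar> \<le> C" if g: "continuous_on {0..1} g" for g
  proof -
    have "- C \<le> lipschitz_envelope F k g"
    proof (rule lipschitz_envelope_greatest)
      fix h :: "real \<Rightarrow> real" assume h: "continuous_on {0..1} h"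
      have "0 \<le> k * sup_dist g h" using k sup_dist_nonneg[OF g h] by simp
      with F_bounded[OF h] show "- C \<le> F h + k * sup_dist g h" by linarith
    qed
    moreover have "lipschitz_envelope F k g \<le> C"
      using lipschitz_envelope_le[OF g k] F_bounded[OF g] by linarith
    ultimately show ?thesis by simp
  qed
  moreover have "\<bar>lipschitz_envelope F k g - lipschitz_envelope F k h\<bar> \<le> k * sup_dist g h"
    if "continuous_on {0..1} g" "continuous_on {0..1} h" for g h
    using diff[OF that] diff[OF that(2,1)] by (simp add: abs_le_iff sup_dist_commute algebra_simps)
  ultimately show ?thesis
    using k by (simp add: bounded_lipschitz_functional_C01_def)
qed

end

lemma lipschitz_envelope_tendsto:
  assumes F: "bounded_continuous_functional_C01 F" and g: "continuous_on {0..1} g"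
  shows "(\<lambda>k. lipschitz_envelope F (real k) g) \<longlonglongrightarrow> F g"
proof (rule tendstoI)
  fix e :: real assume e: "e > 0"
  obtain C where C: "\<And>g. continuous_on {0..1} g \<Longrightarrow> \<bar>F g\<bar> \<le> C"
    using bounded_continuous_functional_C01_bounded[OF F] by blast
  obtain \<delta> where \<delta>: "\<delta> > 0"
    "\<And>h. continuous_on {0..1} h \<Longrightarrow> sup_dist h g < \<delta> \<Longrightarrow> \<bar>F h - F g\<bar> < e / 2"
    using bounded_continuous_functional_C01_continuous[OF F g half_gt_zero[OF e]] by blast
  have "eventually (\<lambda>k. 2 * C / \<delta> \<le> real k) sequentially"
    by (intro eventually_compose_filterlim[OF eventually_ge_at_top filterlim_real_sequentially])
  then show "eventually (\<lambda>k. dist (lipschitz_envelope F (real k) g) (F g) < e) sequentially"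
  proof eventually_elim
    case (elim k)
    have "F g - e / 2 \<le> lipschitz_envelope F (real k) g"
    proof (rule lipschitz_envelope_greatest[OF C])
      fix h :: "real \<Rightarrow> real" assume h: "continuous_on {0..1} h"
      show "F g - e / 2 \<le> F h + real k * sup_dist g h"
      proof (cases "sup_dist g h < \<delta>")
        case True
        with \<delta>(2)[OF h] have "\<bar>F h - F g\<bar> < e / 2" by (simp add: sup_dist_commute)
        moreover have "0 \<le> real k * sup_dist g h" using sup_dist_nonneg[OF g h] by simp
        ultimately show ?thesis by linarith
      next
        case False
        have "2 * C \<le> real k * \<delta>" using elim \<delta>(1) by (simp add: field_simps)
        also have "\<dots> \<le> real k * sup_dist g h" using False by (intro mult_left_mono) auto
        finally show ?thesis using C[OF g] C[OF h] e by linarith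
      qed
    qed
    with lipschitz_envelope_le[of F C g "real k", OF C g] e show ?case
      by (simp add: dist_real_def)
  qed
qed

definition random_path_C01 :: "'a measure \<Rightarrow> ('a \<Rightarrow> real \<Rightarrow> real) \<Rightarrow> bool" where
  "random_path_C01 M X \<longleftrightarrow> (\<forall>\<omega>\<in>space M. continuous_on {0..1} (X \<omega>)) \<and>
     (\<forall>F. bounded_continuous_functional_C01 F \<longrightarrow> (\<lambda>\<omega>. F (X \<omega>)) \<in> borel_measurable M)"

definition weak_conv_C01 ::
    "(nat \<Rightarrow> 'a measure) \<Rightarrow> (nat \<Rightarrow> 'a \<Rightarrow> real \<Rightarrow> real) \<Rightarrow> 'b measure \<Rightarrow> ('b \<Rightarrow> real \<Rightarrow> real) \<Rightarrow> bool" where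
  "weak_conv_C01 P X M Y \<longleftrightarrow> (\<forall>F. bounded_continuous_functional_C01 F \<longrightarrow>
     (\<lambda>n. \<integral>\<omega>. F (X n \<omega>) \<partial>P n) \<longlonglongrightarrow> (\<integral>\<omega>. F (Y \<omega>) \<partial>M))"

lemma random_path_C01_continuous:
  "random_path_C01 M X \<Longrightarrow> \<omega> \<in> space M \<Longrightarrow> continuous_on {0..1} (X \<omega>)"
  by (simp add: random_path_C01_def)

lemma random_path_C01_measurable:
  "random_path_C01 M X \<Longrightarrow> bounded_continuous_functional_C01 F \<Longrightarrow> (\<lambda>\<omega>. F (X \<omega>)) \<in> borel_measurable M"
  by (simp add: random_path_C01_def)

lemma integrable_functional_C01:
  assumes "prob_space M" "random_path_C01 M X" "bounded_continuous_functional_C01 F"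
  shows "integrable M (\<lambda>\<omega>. F (X \<omega>))"
proof -
  interpret prob_space M by fact
  obtain C where "\<And>g. continuous_on {0..1} g \<Longrightarrow> \<bar>F g\<bar> \<le> C"
    using bounded_continuous_functional_C01_bounded[OF assms(3)] by blast
  then show ?thesis
    using assms by (intro integrable_const_bound[where B = C] AE_I2)
      (auto simp: random_path_C01_def)
qed

lemma weak_conv_C01_pointwise:
  assumes M: "prob_space M" and X: "\<And>n. random_path_C01 M (X n)" and Y: "random_path_C01 M Y"
    and lim: "\<And>\<omega>. \<omega> \<in> space M \<Longrightarrow> (\<lambda>n. sup_dist (X n \<omega>) (Y \<omega>)) \<longlonglongrightarrow> 0"
  shows "weak_conv_C01 (\<lambda>_. M) X M Y"
  unfolding weak_conv_C01_def
proof (intro allI impI)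
  fix F assume F: "bounded_continuous_functional_C01 F"
  interpret prob_space M by fact
  obtain C where C: "\<And>g. continuous_on {0..1} g \<Longrightarrow> \<bar>F g\<bar> \<le> C"
    using bounded_continuous_functional_C01_bounded[OF F] by blast
  show "(\<lambda>n. expectation (\<lambda>\<omega>. F (X n \<omega>))) \<longlonglongrightarrow> expectation (\<lambda>\<omega>. F (Y \<omega>))"
  proof (rule integral_dominated_convergence[where w = "\<lambda>_. C"])
    show "AE \<omega> in M. (\<lambda>n. F (X n \<omega>)) \<longlonglongrightarrow> F (Y \<omega>)"
    proof (rule AE_I2)
      fix \<omega> assume "\<omega> \<in> space M"
      with X Y lim show "(\<lambda>n. F (X n \<omega>)) \<longlonglongrightarrow> F (Y \<omega>)"
        by (intro bounded_continuous_functional_C01_tendsto[OF F, of "Y \<omega>" "\<lambda>n. X n \<omega>"])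
          (auto simp: random_path_C01_def)
    qed
  qed (use F X Y C in \<open>auto simp: random_path_C01_def\<close>)
qed

lemma eventually_expectation_gt_of_lipschitz:
  assumes P: "\<And>n. prob_space (P n)" and M: "prob_space M"
    and X: "\<And>n. random_path_C01 (P n) (X n)" and Y: "random_path_C01 M Y"
    and lip: "\<And>C K F. bounded_lipschitz_functional_C01 C K F \<Longrightarrow>
      (\<lambda>n. \<integral>\<omega>. F (X n \<omega>) \<partial>P n) \<longlonglongrightarrow> (\<integral>\<omega>. F (Y \<omega>) \<partial>M)"
    and F: "bounded_continuous_functional_C01 F" and a: "a < (\<integral>\<omega>. F (Y \<omega>) \<partial>M)"
  shows "eventually (\<lambda>n. a < (\<integral>\<omega>. F (X n \<omega>) \<partial>P n)) sequentially"
proof -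
  interpret M: prob_space M by fact
  obtain C where C: "\<And>g. continuous_on {0..1} g \<Longrightarrow> \<bar>F g\<bar> \<le> C"
    using bounded_continuous_functional_C01_bounded[OF F] by blast
  let ?E = "\<lambda>k. lipschitz_envelope F (real k)"
  have E_lipschitz: "bounded_lipschitz_functional_C01 C (real k) (?E k)" for k
    by (rule bounded_lipschitz_lipschitz_envelope[OF C]) auto
  have E_continuous: "bounded_continuous_functional_C01 (?E k)" for k
    by (rule bounded_lipschitz_imp_bounded_continuous[OF E_lipschitz])
  have "(\<lambda>k. \<integral>\<omega>. ?E k (Y \<omega>) \<partial>M) \<longlonglongrightarrow> (\<integral>\<omega>. F (Y \<omega>) \<partial>M)"
  proof (rule integral_dominated_convergence[where w = "\<lambda>_. C"])
    show "AE \<omega> in M. (\<lambda>k. ?E k (Y \<omega>)) \<longlonglongrightarrow> F (Y \<omega>)"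
      using Y by (intro AE_I2 lipschitz_envelope_tendsto[OF F] random_path_C01_continuous)
    show "AE \<omega> in M. norm (?E k (Y \<omega>)) \<le> C" for k
      using bounded_lipschitz_functional_C01D(2)[OF E_lipschitz] Y by (auto simp: random_path_C01_def)
  qed (use Y F E_continuous in \<open>auto simp: random_path_C01_def\<close>)
  then have "eventually (\<lambda>k. a < (\<integral>\<omega>. ?E k (Y \<omega>) \<partial>M)) sequentially"
    using a by (rule order_tendstoD)
  then obtain k where "a < (\<integral>\<omega>. ?E k (Y \<omega>) \<partial>M)"
    by (auto simp: eventually_sequentially)
  then have "eventually (\<lambda>n. a < (\<integral>\<omega>. ?E k (X n \<omega>) \<partial>P n)) sequentially"
    using lip[OF E_lipschitz] by (intro order_tendstoD)
  then show ?thesis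
  proof eventually_elim
    case (elim n)
    also have "(\<integral>\<omega>. ?E k (X n \<omega>) \<partial>P n) \<le> (\<integral>\<omega>. F (X n \<omega>) \<partial>P n)"
      using random_path_C01_continuous[OF X]
      by (intro integral_mono integrable_functional_C01[OF P X] E_continuous F
        lipschitz_envelope_le[of F C, OF C]) auto
    finally show ?case .
  qed
qed

theorem weak_conv_C01_of_lipschitz:
  assumes P: "\<And>n. prob_space (P n)" and M: "prob_space M"
    and X: "\<And>n. random_path_C01 (P n) (X n)" and Y: "random_path_C01 M Y"
    and lip: "\<And>C K F. bounded_lipschitz_functional_C01 C K F \<Longrightarrow>
      (\<lambda>n. \<integral>\<omega>. F (X n \<omega>) \<partial>P n) \<longlonglongrightarrow> (\<integral>\<omega>. F (Y \<omega>) \<partial>M)"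
  shows "weak_conv_C01 P X M Y"
  unfolding weak_conv_C01_def
proof (intro allI impI)
  have lower: "eventually (\<lambda>n. a < (\<integral>\<omega>. F (X n \<omega>) \<partial>P n)) sequentially"
    if "bounded_continuous_functional_C01 F" "a < (\<integral>\<omega>. F (Y \<omega>) \<partial>M)" for F a
    by (rule eventually_expectation_gt_of_lipschitz[of P M X Y F a]) (fact P M X Y lip that)+
  fix F assume F: "bounded_continuous_functional_C01 F"
  show "(\<lambda>n. \<integral>\<omega>. F (X n \<omega>) \<partial>P n) \<longlonglongrightarrow> (\<integral>\<omega>. F (Y \<omega>) \<partial>M)"
  proof (rule order_tendstoI)
    show "eventually (\<lambda>n. a < (\<integral>\<omega>. F (X n \<omega>) \<partial>P n)) sequentially" if "a < (\<integral>\<omega>. F (Y \<omega>) \<partial>M)" for a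
      using lower[OF F that] .
    show "eventually (\<lambda>n. (\<integral>\<omega>. F (X n \<omega>) \<partial>P n) < a) sequentially" if "(\<integral>\<omega>. F (Y \<omega>) \<partial>M) < a" for a
      using lower[OF bounded_continuous_functional_C01_uminus[OF F], of "- a"] that by simp
  qed
qed

definition uniformly_close_in_prob ::
    "'a measure \<Rightarrow> ('a \<Rightarrow> real \<Rightarrow> real) \<Rightarrow> ('a \<Rightarrow> real \<Rightarrow> real) \<Rightarrow> real \<Rightarrow> real \<Rightarrow> bool" where
  "uniformly_close_in_prob M X Y \<eta> \<epsilon> \<longleftrightarrow>
     (\<exists>A\<in>sets M. measure M A \<le> \<epsilon> \<and> (\<forall>\<omega>\<in>space M - A. sup_dist (X \<omega>) (Y \<omega>) \<le> \<eta>))"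

lemma expectation_lipschitz_diff_le:
  assumes M: "prob_space M" and X: "random_path_C01 M X" and Y: "random_path_C01 M Y"
    and F: "bounded_lipschitz_functional_C01 C K F"
    and close: "uniformly_close_in_prob M X Y \<eta> \<epsilon>" and \<eta>: "\<eta> \<ge> 0"
  shows "\<bar>(\<integral>\<omega>. F (X \<omega>) \<partial>M) - (\<integral>\<omega>. F (Y \<omega>) \<partial>M)\<bar> \<le> K * \<eta> + 2 * C * \<epsilon>"
proof -
  interpret prob_space M by fact
  note F_lipschitz = bounded_lipschitz_functional_C01D[OF F]
  note F_integrable = integrable_functional_C01[OF M _ bounded_lipschitz_imp_bounded_continuous[OF F]]
  obtain A where A: "A \<in> sets M" "prob A \<le> \<epsilon>"
    and outside: "\<And>\<omega>. \<omega> \<in> space M - A \<Longrightarrow> sup_dist (X \<omega>) (Y \<omega>) \<le> \<eta>"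
    using close by (auto simp: uniformly_close_in_prob_def)
  have "\<bar>F (X \<omega>) - F (Y \<omega>)\<bar> \<le> K * \<eta> + 2 * C * indicator A \<omega>" if \<omega>: "\<omega> \<in> space M" for \<omega>
  proof (cases "\<omega> \<in> A")
    case True
    have "\<bar>F (X \<omega>)\<bar> \<le> C" "\<bar>F (Y \<omega>)\<bar> \<le> C" "0 \<le> K * \<eta>"
      using X Y \<omega> F_lipschitz(1) \<eta> by (auto intro!: F_lipschitz(2) random_path_C01_continuous)
    with True show ?thesis by simp
  next
    case False
    have "\<bar>F (X \<omega>) - F (Y \<omega>)\<bar> \<le> K * sup_dist (X \<omega>) (Y \<omega>)"
      using X Y \<omega> by (intro F_lipschitz(3) random_path_C01_continuous)
    also have "\<dots> \<le> K * \<eta>" using outside \<omega> False F_lipschitz(1) by (intro mult_left_mono) auto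
    finally show ?thesis using False by simp
  qed
  then have "expectation (\<lambda>\<omega>. \<bar>F (X \<omega>) - F (Y \<omega>)\<bar>) \<le> expectation (\<lambda>\<omega>. K * \<eta> + 2 * C * indicator A \<omega>)"
    using F_integrable X Y A(1) by (intro integral_mono) (auto simp: emeasure_eq_measure)
  also have "\<dots> = K * \<eta> + 2 * C * prob A"
    using A(1) by (simp add: emeasure_eq_measure prob_space)
  also have "\<dots> \<le> K * \<eta> + 2 * C * \<epsilon>" using A(2) bounded_lipschitz_functional_C01_bound_nonneg[OF F]
    by (intro add_left_mono mult_left_mono) auto
  finally show ?thesis
    using integral_abs_bound[of M "\<lambda>\<omega>. F (X \<omega>) - F (Y \<omega>)"] F_integrable X Y by simp
qed

lemma expectation_lipschitz_close:
  fixes F :: "(real \<Rightarrow> real) \<Rightarrow> real"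
  assumes F: "bounded_lipschitz_functional_C01 C K F" and e: "e > 0"
  obtains \<eta> \<epsilon> where "\<eta> > 0" "\<epsilon> > 0"
    "\<And>(M :: 'a measure) X Y. prob_space M \<Longrightarrow> random_path_C01 M X \<Longrightarrow> random_path_C01 M Y \<Longrightarrow>
      uniformly_close_in_prob M X Y \<eta> \<epsilon> \<Longrightarrow> dist (\<integral>\<omega>. F (X \<omega>) \<partial>M) (\<integral>\<omega>. F (Y \<omega>) \<partial>M) < e"
proof
  have K: "K \<ge> 0" and C: "C \<ge> 0"
    using bounded_lipschitz_functional_C01D(1)[OF F] bounded_lipschitz_functional_C01_bound_nonneg[OF F] .
  show pos: "e / (2 * (K + 1)) > 0" "e / (4 * (C + 1)) > 0" using e K C by auto
  fix M :: "'a measure" and X Y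
  assume "prob_space M" "random_path_C01 M X" "random_path_C01 M Y"
    "uniformly_close_in_prob M X Y (e / (2 * (K + 1))) (e / (4 * (C + 1)))"
  then have "\<bar>(\<integral>\<omega>. F (X \<omega>) \<partial>M) - (\<integral>\<omega>. F (Y \<omega>) \<partial>M)\<bar> \<le> K * (e / (2 * (K + 1))) + 2 * C * (e / (4 * (C + 1)))"
    using pos by (intro expectation_lipschitz_diff_le F) auto
  moreover have "K * (e / (2 * (K + 1))) < e / 2" "2 * C * (e / (4 * (C + 1))) < e / 2"
    using e K C by (simp_all add: field_simps)
  ultimately show "dist (\<integral>\<omega>. F (X \<omega>) \<partial>M) (\<integral>\<omega>. F (Y \<omega>) \<partial>M) < e"
    unfolding dist_real_def by linarith
qed

theorem weak_conv_C01_double_limit: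
  fixes P :: "nat \<Rightarrow> 'a measure"
  assumes P: "\<And>n. prob_space (P n)" and M: "prob_space M"
    and X: "\<And>n. random_path_C01 (P n) (X n)" and V: "\<And>m n. random_path_C01 (P n) (V m n)"
    and Y: "random_path_C01 M Y"
    and inner: "\<forall>\<^sub>F m in sequentially. weak_conv_C01 P (V m) M (Z m)"
    and outer: "weak_conv_C01 (\<lambda>_. M) Z M Y"
    and close: "\<And>\<eta> \<epsilon>. \<eta> > 0 \<Longrightarrow> \<epsilon> > 0 \<Longrightarrow>
      \<forall>\<^sub>F m in sequentially. \<forall>\<^sub>F n in sequentially. uniformly_close_in_prob (P n) (X n) (V m n) \<eta> \<epsilon>"
  shows "weak_conv_C01 P X M Y"
proof (rule weak_conv_C01_of_lipschitz[OF P M X Y], rule tendstoI)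
  fix C K F and e :: real assume F: "bounded_lipschitz_functional_C01 C K F" and "e > 0"
  then have e: "e / 3 > 0" by simp
  have F_continuous: "bounded_continuous_functional_C01 F"
    by (rule bounded_lipschitz_imp_bounded_continuous[OF F])
  obtain \<eta> \<epsilon> where pos: "\<eta> > 0" "\<epsilon> > 0"
    and small: "\<And>(Q :: 'a measure) X Y. prob_space Q \<Longrightarrow> random_path_C01 Q X \<Longrightarrow> random_path_C01 Q Y \<Longrightarrow>
      uniformly_close_in_prob Q X Y \<eta> \<epsilon> \<Longrightarrow> dist (\<integral>\<omega>. F (X \<omega>) \<partial>Q) (\<integral>\<omega>. F (Y \<omega>) \<partial>Q) < e / 3"
    by (rule expectation_lipschitz_close[OF F e]) blast
  have "\<forall>\<^sub>F m in sequentially. dist (\<integral>\<omega>. F (Z m \<omega>) \<partial>M) (\<integral>\<omega>. F (Y \<omega>) \<partial>M) < e / 3"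
    using outer F_continuous e unfolding weak_conv_C01_def by (intro tendstoD) auto
  then have "\<forall>\<^sub>F m in sequentially. dist (\<integral>\<omega>. F (Z m \<omega>) \<partial>M) (\<integral>\<omega>. F (Y \<omega>) \<partial>M) < e / 3 \<and>
      weak_conv_C01 P (V m) M (Z m) \<and>
      (\<forall>\<^sub>F n in sequentially. uniformly_close_in_prob (P n) (X n) (V m n) \<eta> \<epsilon>)"
    using inner close[OF pos] by eventually_elim auto
  then obtain m where Z_close: "dist (\<integral>\<omega>. F (Z m \<omega>) \<partial>M) (\<integral>\<omega>. F (Y \<omega>) \<partial>M) < e / 3"
    and V_conv: "weak_conv_C01 P (V m) M (Z m)"
    and X_close: "\<forall>\<^sub>F n in sequentially. uniformly_close_in_prob (P n) (X n) (V m n) \<eta> \<epsilon>"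
    using eventually_happens'[OF sequentially_bot] by blast
  have "\<forall>\<^sub>F n in sequentially. dist (\<integral>\<omega>. F (V m n \<omega>) \<partial>P n) (\<integral>\<omega>. F (Z m \<omega>) \<partial>M) < e / 3"
    using V_conv F_continuous e unfolding weak_conv_C01_def by (intro tendstoD) auto
  with X_close show "\<forall>\<^sub>F n in sequentially. dist (\<integral>\<omega>. F (X n \<omega>) \<partial>P n) (\<integral>\<omega>. F (Y \<omega>) \<partial>M) < e"
  proof eventually_elim
    case (elim n)
    with small[OF P X V, of n m] Z_close show ?case unfolding dist_real_def by linarith
  qed
qed

corollary weak_conv_C01_converging_together:
  assumes "\<And>n. prob_space (P n)" "prob_space M"
    and "\<And>n. random_path_C01 (P n) (X n)" "\<And>n. random_path_C01 (P n) (V n)" "random_path_C01 M Y"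
    and "weak_conv_C01 P V M Y"
    and "\<And>\<eta> \<epsilon>. \<eta> > 0 \<Longrightarrow> \<epsilon> > 0 \<Longrightarrow>
      \<forall>\<^sub>F n in sequentially. uniformly_close_in_prob (P n) (X n) (V n) \<eta> \<epsilon>"
  shows "weak_conv_C01 P X M Y"
  using assms by (intro weak_conv_C01_double_limit[of P M X "\<lambda>_. V" Y "\<lambda>_. Y"])
    (auto simp: weak_conv_C01_def)

section \<open>Polygonal paths\<close>

definition poly_path :: "nat \<Rightarrow> (nat \<Rightarrow> real) \<Rightarrow> real \<Rightarrow> real" where
  "poly_path m x t = (\<Sum>j<m. x j * max 0 (min 1 (real m * t - real j)))"

abbreviation rescaled_path :: "nat \<Rightarrow> (nat \<Rightarrow> real) \<Rightarrow> real \<Rightarrow> real" where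
  "rescaled_path n x \<equiv> poly_path n (\<lambda>i. x i / sqrt (real n))"

lemma poly_path_cong: "(\<And>j. j < m \<Longrightarrow> x j = y j) \<Longrightarrow> poly_path m x = poly_path m y"
  by (auto simp: poly_path_def fun_eq_iff intro!: sum.cong)

lemma continuous_on_poly_path: "continuous_on A (poly_path m x)"
  unfolding poly_path_def[abs_def]
  by (intro continuous_on_sum continuous_on_mult continuous_on_max continuous_on_min
      continuous_on_diff continuous_on_const continuous_on_id)

lemma poly_path_at_1: "poly_path m x 1 = (\<Sum>j<m. x j)"
  unfolding poly_path_def
proof (intro sum.cong refl)
  fix j assume "j \<in> {..<m}"
  then have "real j + 1 \<le> real m" by simp
  then show "x j * max 0 (min 1 (real m * 1 - real j)) = x j" by simp
qed

lemma poly_path_on_cell: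
  assumes "j < m" "0 \<le> \<theta>" "\<theta> \<le> 1" "real m * t = real j + \<theta>"
  shows "poly_path m x t = (1 - \<theta>) * (\<Sum>i<j. x i) + \<theta> * (\<Sum>i<Suc j. x i)"
proof -
  have weight: "max 0 (min 1 (real m * t - real i)) = (if i < j then 1 else if i = j then \<theta> else 0)" for i
  proof -
    consider "real i + 1 \<le> real j" "i < j" | "i = j" | "real j + 1 \<le> real i" "j < i"
      by (cases i j rule: linorder_cases) auto
    then show ?thesis using assms by cases auto
  qed
  have "poly_path m x t = (\<Sum>i\<in>{..<m}. x i * (if i < j then 1 else if i = j then \<theta> else 0))"
    by (simp only: poly_path_def weight)
  also have "\<dots> = (\<Sum>i\<in>{..<Suc j}. x i * (if i < j then 1 else if i = j then \<theta> else 0))"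
    using assms(1) by (intro sum.mono_neutral_right) auto
  also have "\<dots> = (\<Sum>i<j. x i) + \<theta> * x j" by simp
  finally show ?thesis by (simp add: algebra_simps)
qed

lemma unit_interval_cell:
  assumes "m > 0" "0 \<le> t" "t < 1"
  obtains j \<theta> where "j < m" "0 \<le> \<theta>" "\<theta> < 1" "real m * t = real j + \<theta>"
proof
  have "real m * t < real m * 1" using assms by (intro mult_strict_left_mono) auto
  then show "nat \<lfloor>real m * t\<rfloor> < m" using assms by (simp add: nat_less_iff floor_less_iff)
  show "real m * t = real (nat \<lfloor>real m * t\<rfloor>) + frac (real m * t)"
    using assms by (simp add: frac_def)
qed (auto simp: frac_lt_1)

lemma abs_convex_combination_diff_le:
  fixes a b c :: real
  assumes "0 \<le> \<theta>" "\<theta> \<le> 1" "\<bar>a - c\<bar> \<le> d" "\<bar>b - c\<bar> \<le> d"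
  shows "\<bar>(1 - \<theta>) * a + \<theta> * b - c\<bar> \<le> d"
proof -
  have "(1 - \<theta>) * a + \<theta> * b - c = (1 - \<theta>) * (a - c) + \<theta> * (b - c)" by (simp add: algebra_simps)
  also have "\<bar>\<dots>\<bar> \<le> (1 - \<theta>) * \<bar>a - c\<bar> + \<theta> * \<bar>b - c\<bar>"
    using assms by (intro order_trans[OF abs_triangle_ineq]) (simp add: abs_mult)
  also have "\<dots> \<le> d" using assms by (intro convex_bound_le) auto
  finally show ?thesis .
qed

lemma sup_dist_poly_path_le:
  assumes "\<And>k. k \<le> m \<Longrightarrow> \<bar>(\<Sum>i<k. x i) - (\<Sum>i<k. y i)\<bar> \<le> d"
  shows "sup_dist (poly_path m x) (poly_path m y) \<le> d"
proof (rule sup_dist_least)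
  fix t :: real assume t: "t \<in> {0..1}"
  show "\<bar>poly_path m x t - poly_path m y t\<bar> \<le> d"
  proof (cases "m > 0 \<and> t < 1")
    case True
    with t obtain j \<theta> where cell: "j < m" "0 \<le> \<theta>" "\<theta> < 1" "real m * t = real j + \<theta>"
      using unit_interval_cell[of m t] by auto
    have "poly_path m x t - poly_path m y t =
        (1 - \<theta>) * ((\<Sum>i<j. x i) - (\<Sum>i<j. y i)) + \<theta> * ((\<Sum>i<Suc j. x i) - (\<Sum>i<Suc j. y i)) - 0"
      using cell by (simp add: poly_path_on_cell[of j m \<theta>] algebra_simps)
    also have "\<bar>\<dots>\<bar> \<le> d"
      using cell assms[of j] assms[of "Suc j"] by (intro abs_convex_combination_diff_le) auto
    finally show ?thesis .
  next
    case False
    with t have "m = 0 \<or> t = 1" by auto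
    then show ?thesis using assms[of m] by (auto simp: poly_path_at_1 poly_path_def)
  qed
qed

lemma sup_dist_poly_path_le_sum:
  "sup_dist (poly_path m x) (poly_path m y) \<le> (\<Sum>j<m. \<bar>x j - y j\<bar>)"
proof (rule sup_dist_poly_path_le)
  fix k assume "k \<le> m"
  have "\<bar>(\<Sum>i<k. x i) - (\<Sum>i<k. y i)\<bar> \<le> (\<Sum>i<k. \<bar>x i - y i\<bar>)"
    unfolding sum_subtractf[symmetric] by (rule sum_abs)
  also have "\<dots> \<le> (\<Sum>i<m. \<bar>x i - y i\<bar>)"
    using \<open>k \<le> m\<close> by (intro sum_mono2) auto
  finally show "\<bar>(\<Sum>i<k. x i) - (\<Sum>i<k. y i)\<bar> \<le> (\<Sum>i<m. \<bar>x i - y i\<bar>)" .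
qed

lemma functional_C01_poly_path_tendsto:
  assumes F: "bounded_continuous_functional_C01 F"
    and lim: "\<And>j. j < m \<Longrightarrow> ((\<lambda>n. x n j) \<longlongrightarrow> y j) A"
  shows "((\<lambda>n. F (poly_path m (x n))) \<longlongrightarrow> F (poly_path m y)) A"
proof (rule bounded_continuous_functional_C01_tendsto[OF F continuous_on_poly_path continuous_on_poly_path])
  have "((\<lambda>n. \<Sum>j<m. \<bar>x n j - y j\<bar>) \<longlongrightarrow> (\<Sum>j<m. \<bar>y j - y j\<bar>)) A"
    using lim by (intro tendsto_intros) auto
  then show "((\<lambda>n. sup_dist (poly_path m (x n)) (poly_path m y)) \<longlongrightarrow> 0) A"
    by (intro sup_dist_tendsto_0[OF continuous_on_poly_path continuous_on_poly_path
          always_eventually[OF allI[OF sup_dist_poly_path_le_sum]]]) simp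
qed

lemma random_path_C01_poly_path:
  assumes X: "\<And>j. j < m \<Longrightarrow> X j \<in> borel_measurable M"
  shows "random_path_C01 M (\<lambda>\<omega>. poly_path m (\<lambda>j. X j \<omega>))"
  unfolding random_path_C01_def
proof (intro conjI ballI allI impI continuous_on_poly_path)
  fix F assume F: "bounded_continuous_functional_C01 F"
  have "continuous_on UNIV (\<lambda>x :: nat \<Rightarrow> real. F (poly_path m x))"
  proof (clarsimp simp: continuous_on_def)
    fix x :: "nat \<Rightarrow> real"
    have "((\<lambda>y. y j) \<longlongrightarrow> x j) (at x)" for j
      using continuous_on_product_coordinates[of j] by (auto simp: continuous_on_def)
    then show "((\<lambda>x. F (poly_path m x)) \<longlongrightarrow> F (poly_path m x)) (at x)"
      by (rule functional_C01_poly_path_tendsto[OF F])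
  qed
  then have "(\<lambda>x. F (poly_path m x)) \<in> borel_measurable (Pi\<^sub>M UNIV (\<lambda>_::nat. borel))"
    using borel_measurable_continuous_onI by (simp cong: measurable_cong_sets add: sets_PiM_equal_borel)
  moreover have "(\<lambda>\<omega> j. if j < m then X j \<omega> else 0) \<in> measurable M (Pi\<^sub>M UNIV (\<lambda>_. borel))"
  proof (rule measurable_PiM_single')
    show "(\<lambda>\<omega>. if j < m then X j \<omega> else 0) \<in> borel_measurable M" for j
      using X by (cases "j < m") auto
  qed auto
  ultimately have "(\<lambda>\<omega>. F (poly_path m (\<lambda>j. if j < m then X j \<omega> else 0))) \<in> borel_measurable M"
    by (rule measurable_compose[rotated])
  then show "(\<lambda>\<omega>. F (poly_path m (\<lambda>j. X j \<omega>))) \<in> borel_measurable M"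
    by (simp cong: poly_path_cong)
qed

definition interpolation :: "nat \<Rightarrow> (real \<Rightarrow> real) \<Rightarrow> real \<Rightarrow> real" where
  "interpolation m g = poly_path m (\<lambda>j. g (real (Suc j) / real m) - g (real j / real m))"

lemma interpolation_on_cell:
  assumes "j < m" "0 \<le> \<theta>" "\<theta> \<le> 1" "real m * t = real j + \<theta>" "g 0 = 0"
  shows "interpolation m g t = (1 - \<theta>) * g (real j / real m) + \<theta> * g (real (Suc j) / real m)"
proof -
  have "(\<Sum>i<k. g (real (Suc i) / real m) - g (real i / real m)) = g (real k / real m)" for k
    using sum_lessThan_telescope[of "\<lambda>i. g (real i / real m)" k] assms(5) by simp
  then show ?thesis
    unfolding interpolation_def poly_path_on_cell[OF assms(1-4)] by simp
qed

lemma sup_dist_interpolation_le: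
  assumes m: "m > 0" and g: "g 0 = 0"
    and osc: "\<And>s t. s \<in> {0..1} \<Longrightarrow> t \<in> {0..1} \<Longrightarrow> \<bar>s - t\<bar> \<le> 1 / real m \<Longrightarrow> \<bar>g s - g t\<bar> \<le> e"
  shows "sup_dist (interpolation m g) g \<le> e"
proof (rule sup_dist_least)
  fix t :: real assume t: "t \<in> {0..1}"
  show "\<bar>interpolation m g t - g t\<bar> \<le> e"
  proof (cases "t < 1")
    case True
    with t m obtain j \<theta> where cell: "j < m" "0 \<le> \<theta>" "\<theta> < 1" "real m * t = real j + \<theta>"
      using unit_interval_cell[of m t] by auto
    have "real j / real m - t = - \<theta> / real m" "real (Suc j) / real m - t = (1 - \<theta>) / real m"
      using cell m by (simp_all add: field_simps)
    then have "\<bar>real j / real m - t\<bar> \<le> 1 / real m" "\<bar>real (Suc j) / real m - t\<bar> \<le> 1 / real m"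
      using cell by (simp_all add: abs_le_iff divide_right_mono)
    then have "\<bar>g (real j / real m) - g t\<bar> \<le> e" "\<bar>g (real (Suc j) / real m) - g t\<bar> \<le> e"
      using cell t by (auto intro!: osc)
    with cell g show ?thesis
      by (simp only: interpolation_on_cell[of j m \<theta>] abs_convex_combination_diff_le less_imp_le)
  next
    case False
    with t have "t = 1" by simp
    moreover have "interpolation m g 1 = g 1"
      using sum_lessThan_telescope[of "\<lambda>i. g (real i / real m)" m] m g
      by (simp add: interpolation_def poly_path_at_1)
    ultimately show ?thesis using osc[of 1 1] by simp
  qed
qed

lemma sup_dist_interpolation_tendsto:
  assumes g: "continuous_on {0..1} g" "g 0 = 0"
  shows "(\<lambda>m. sup_dist (interpolation m g) g) \<longlonglongrightarrow> 0"
proof (rule tendstoI)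
  fix e :: real assume e: "e > 0"
  have "uniformly_continuous_on {0..1} g"
    using g by (intro compact_uniformly_continuous) auto
  then obtain \<delta> where \<delta>: "\<delta> > 0"
    "\<And>s t. s \<in> {0..1} \<Longrightarrow> t \<in> {0..1} \<Longrightarrow> \<bar>s - t\<bar> < \<delta> \<Longrightarrow> \<bar>g s - g t\<bar> < e / 2"
    using half_gt_zero[OF e] unfolding uniformly_continuous_on_def dist_real_def
    by (metis abs_minus_commute)
  have "eventually (\<lambda>m. 1 / real m < \<delta>) sequentially"
    by (rule order_tendstoD(2)[OF lim_1_over_n \<delta>(1)])
  then show "eventually (\<lambda>m. dist (sup_dist (interpolation m g) g) 0 < e) sequentially"
    using eventually_gt_at_top[of 0]
  proof eventually_elim
    case (elim m)
    have "sup_dist (interpolation m g) g \<le> e / 2"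
    proof (rule sup_dist_interpolation_le[of m g, OF elim(2) g(2)])
      fix s t :: real assume "s \<in> {0..1}" "t \<in> {0..1}" "\<bar>s - t\<bar> \<le> 1 / real m"
      with elim(1) show "\<bar>g s - g t\<bar> \<le> e / 2" by (intro less_imp_le \<delta>(2)) auto
    qed
    moreover have "0 \<le> sup_dist (interpolation m g) g"
      unfolding interpolation_def by (rule sup_dist_nonneg[OF continuous_on_poly_path g(1)])
    ultimately show ?case using e by simp
  qed
qed

lemma random_path_C01_interpolation:
  assumes "\<And>t. t \<in> {0..1} \<Longrightarrow> (\<lambda>\<omega>. X \<omega> t) \<in> borel_measurable M"
  shows "random_path_C01 M (\<lambda>\<omega>. interpolation m (X \<omega>))"
  unfolding interpolation_def
  by (intro random_path_C01_poly_path borel_measurable_diff assms) auto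

lemma random_path_C01I:
  assumes "\<And>\<omega>. \<omega> \<in> space M \<Longrightarrow> continuous_on {0..1} (X \<omega>)" "\<And>\<omega>. \<omega> \<in> space M \<Longrightarrow> X \<omega> 0 = 0"
    and "\<And>t. t \<in> {0..1} \<Longrightarrow> (\<lambda>\<omega>. X \<omega> t) \<in> borel_measurable M"
  shows "random_path_C01 M X"
  unfolding random_path_C01_def
proof (intro conjI ballI allI impI assms(1))
  fix F assume F: "bounded_continuous_functional_C01 F"
  show "(\<lambda>\<omega>. F (X \<omega>)) \<in> borel_measurable M"
  proof (rule borel_measurable_LIMSEQ_real)
    fix \<omega> assume "\<omega> \<in> space M"
    then show "(\<lambda>m. F (interpolation m (X \<omega>))) \<longlonglongrightarrow> F (X \<omega>)"
      by (intro bounded_continuous_functional_C01_tendsto[OF F] sup_dist_interpolation_tendsto assms)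
        (simp_all add: interpolation_def continuous_on_poly_path)
  next
    show "(\<lambda>\<omega>. F (interpolation m (X \<omega>))) \<in> borel_measurable M" for m
      by (rule random_path_C01_measurable[OF random_path_C01_interpolation F]) (rule assms(3))
  qed
qed

definition grid :: "nat \<Rightarrow> nat \<Rightarrow> nat \<Rightarrow> nat" where
  "grid m n j = j * n div m"

definition block_length :: "nat \<Rightarrow> nat \<Rightarrow> nat \<Rightarrow> nat" where
  "block_length m n j = grid m n (Suc j) - grid m n j"

definition block_sum :: "nat \<Rightarrow> nat \<Rightarrow> (nat \<Rightarrow> real) \<Rightarrow> nat \<Rightarrow> real" where
  "block_sum m n x j = (\<Sum>i<block_length m n j. x (grid m n j + i))"

lemma grid_mono: "i \<le> j \<Longrightarrow> grid m n i \<le> grid m n j"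
  by (simp add: grid_def div_le_mono)

lemma grid_last: "m > 0 \<Longrightarrow> grid m n m = n"
  by (simp add: grid_def)

lemma grid_Suc: "grid m n (Suc j) = grid m n j + block_length m n j"
  using grid_mono[of j "Suc j" m n] by (simp add: block_length_def)

lemma sum_shift_eq_diff:
  fixes x :: "nat \<Rightarrow> real"
  shows "(\<Sum>i<k. x (a + i)) = (\<Sum>i<a + k. x i) - (\<Sum>i<a. x i)"
  by (induction k) auto

lemma sum_block_sum: "(\<Sum>i<j. block_sum m n x i) = (\<Sum>i<grid m n j. x i)"
proof (induction j)
  case (Suc j)
  then show ?case by (simp add: block_sum_def sum_shift_eq_diff grid_Suc)
qed (simp add: grid_def)

lemma cell_in_grid_block:
  assumes "m > 0" "\<theta> < 1" "\<tau> < 1" "0 \<le> \<theta>" "0 \<le> \<tau>"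
    and "real m * (real k + \<theta>) = real n * (real j + \<tau>)"
  shows "grid m n j \<le> k" "k \<le> grid m n (Suc j)"
proof -
  have "real (j * n) \<le> real n * (real j + \<tau>)" using assms by (simp add: algebra_simps)
  also have "\<dots> < real m * (real k + 1)" using assms by (simp flip: assms(6))
  finally have "real (j * n) < real (Suc k * m)" by (simp add: algebra_simps)
  then have "j * n < Suc k * m" by (simp only: of_nat_less_iff)
  then show "grid m n j \<le> k" by (simp add: grid_def less_mult_imp_div_less less_Suc_eq_le[symmetric])
  have "real (m * k) \<le> real n * (real j + \<tau>)" using assms by (simp flip: assms(6))
  also have "\<dots> \<le> real n * (real j + 1)" using assms by (intro mult_left_mono) auto
  finally have "real (m * k) \<le> real (Suc j * n)" by (simp add: algebra_simps)
  then have "k * m \<le> Suc j * n" by (simp only: of_nat_le_iff mult.commute)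
  with assms(1) show "k \<le> grid m n (Suc j)" by (simp add: grid_def less_eq_div_iff_mult_less_eq)
qed

lemma grid_strict_mono_Suc: "0 < m \<Longrightarrow> m \<le> n \<Longrightarrow> grid m n j < grid m n (Suc j)"
proof -
  assume m: "0 < m" "m \<le> n"
  have "grid m n j + 1 = (j * n + m) div m" using m by (simp add: grid_def)
  also have "\<dots> \<le> grid m n (Suc j)" unfolding grid_def using m by (intro div_le_mono) simp
  finally show ?thesis by simp
qed

context
  fixes m n :: nat and x :: "nat \<Rightarrow> real" and d :: real
  assumes m: "0 < m" "m \<le> n"
    and osc: "\<And>j k. j < m \<Longrightarrow> k \<le> block_length m n j \<Longrightarrow> \<bar>\<Sum>i<k. x (grid m n j + i)\<bar> \<le> d"
begin

lemma abs_partial_sum_diff_grid_le: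
  assumes "j < m" "grid m n j \<le> k" "k \<le> grid m n (Suc j)"
  shows "\<bar>(\<Sum>i<k. x i) - (\<Sum>i<grid m n j. x i)\<bar> \<le> d"
  using osc[of j "k - grid m n j"] assms by (simp add: sum_shift_eq_diff block_length_def)

lemma abs_partial_sum_Suc_diff_grid_le:
  assumes j: "j < m" and k: "grid m n j \<le> k" "k \<le> grid m n (Suc j)" "k < n"
  shows "\<bar>(\<Sum>i<Suc k. x i) - (\<Sum>i<grid m n j. x i)\<bar> \<le> 2 * d"
proof (cases "k = grid m n (Suc j)")
  case True
  have "Suc j \<noteq> m" using True k(3) grid_last[OF m(1)] by auto
  then have "\<bar>(\<Sum>i<Suc k. x i) - (\<Sum>i<grid m n (Suc j). x i)\<bar> \<le> d"
    using True j grid_strict_mono_Suc[OF m, of "Suc j"] by (intro abs_partial_sum_diff_grid_le) auto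
  moreover have "\<bar>(\<Sum>i<grid m n (Suc j). x i) - (\<Sum>i<grid m n j. x i)\<bar> \<le> d"
    using j by (intro abs_partial_sum_diff_grid_le grid_mono) auto
  ultimately show ?thesis by linarith
next
  case False
  then have "\<bar>(\<Sum>i<Suc k. x i) - (\<Sum>i<grid m n j. x i)\<bar> \<le> d"
    using j k by (intro abs_partial_sum_diff_grid_le) auto
  then show ?thesis by simp
qed

lemma sup_dist_poly_path_block_sum_le: "sup_dist (poly_path n x) (poly_path m (block_sum m n x)) \<le> 3 * d"
proof (rule sup_dist_least)
  have d: "0 \<le> d" using osc[OF m(1), of 0] by simp
  fix t :: real assume t: "t \<in> {0..1}"
  show "\<bar>poly_path n x t - poly_path m (block_sum m n x) t\<bar> \<le> 3 * d"
  proof (cases "t < 1")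
    case True
    with t m obtain j \<tau> where j: "j < m" "0 \<le> \<tau>" "\<tau> < 1" "real m * t = real j + \<tau>"
      using unit_interval_cell[of m t] by auto
    from True t m obtain k \<theta> where k: "k < n" "0 \<le> \<theta>" "\<theta> < 1" "real n * t = real k + \<theta>"
      using unit_interval_cell[of n t] by auto
    have "real m * (real k + \<theta>) = real n * (real j + \<tau>)" by (simp flip: j(4) k(4))
    then have k_block: "grid m n j \<le> k" "k \<le> grid m n (Suc j)"
      using cell_in_grid_block[of m \<theta> \<tau> k n j] j k m by auto
    have "\<bar>poly_path n x t - (\<Sum>i<grid m n j. x i)\<bar> \<le> 2 * d"
      unfolding poly_path_on_cell[OF k(1,2) less_imp_le[OF k(3)] k(4)]
      using abs_partial_sum_diff_grid_le[OF j(1) k_block]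
        abs_partial_sum_Suc_diff_grid_le[OF j(1) k_block k(1)] k d
      by (intro abs_convex_combination_diff_le) auto
    moreover have "\<bar>poly_path m (block_sum m n x) t - (\<Sum>i<grid m n j. x i)\<bar> \<le> d"
      unfolding poly_path_on_cell[OF j(1,2) less_imp_le[OF j(3)] j(4)] sum_block_sum
      using j d by (intro abs_convex_combination_diff_le abs_partial_sum_diff_grid_le grid_mono) auto
    ultimately show ?thesis by linarith
  next
    case False
    with t have "t = 1" by simp
    then show ?thesis using d m(1) by (simp add: poly_path_at_1 sum_block_sum grid_last)
  qed
qed

end

section \<open>Independent random variables\<close>

lemma indep_vars_PiM_coordinates:
  assumes N: "\<And>i. i \<in> I \<Longrightarrow> prob_space (N i)" and I: "I \<noteq> {}"
  shows "prob_space.indep_vars (Pi\<^sub>M I N) N (\<lambda>i \<omega>. \<omega> i) I"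
proof -
  interpret Q: prob_space "Pi\<^sub>M I N" by (rule prob_space_PiM) (rule N)
  have "distr (Pi\<^sub>M I N) (Pi\<^sub>M I N) (\<lambda>\<omega>. \<lambda>i\<in>I. \<omega> i) = Pi\<^sub>M I N"
    by (subst distr_cong[of _ _ _ _ _ "\<lambda>\<omega>. \<omega>"]) (auto simp: space_PiM PiE_def extensional_restrict)
  also have "\<dots> = Pi\<^sub>M I (\<lambda>i. distr (Pi\<^sub>M I N) (N i) (\<lambda>\<omega>. \<omega> i))"
    using N by (intro PiM_cong) (simp_all add: distr_PiM_component)
  finally show ?thesis
    by (subst Q.indep_vars_iff_distr_eq_PiM'[OF I]) (auto intro: measurable_component_singleton)
qed

lemma distr_eq_of_indep_vars:
  assumes "prob_space M" "prob_space N" and I: "I \<noteq> {}"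
    and X: "prob_space.indep_vars M S X I" and Y: "prob_space.indep_vars N S Y I"
    and law: "\<And>i. i \<in> I \<Longrightarrow> distr M (S i) (X i) = distr N (S i) (Y i)"
  shows "distr M (Pi\<^sub>M I S) (\<lambda>\<omega>. \<lambda>i\<in>I. X i \<omega>) = distr N (Pi\<^sub>M I S) (\<lambda>\<omega>. \<lambda>i\<in>I. Y i \<omega>)"
proof -
  interpret M: prob_space M by fact
  interpret N: prob_space N by fact
  have "X i \<in> measurable M (S i)" "Y i \<in> measurable N (S i)" if "i \<in> I" for i
    using X Y that by (auto simp: M.indep_vars_def N.indep_vars_def)
  then have "distr M (Pi\<^sub>M I S) (\<lambda>\<omega>. \<lambda>i\<in>I. X i \<omega>) = Pi\<^sub>M I (\<lambda>i. distr M (S i) (X i))"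
    "distr N (Pi\<^sub>M I S) (\<lambda>\<omega>. \<lambda>i\<in>I. Y i \<omega>) = Pi\<^sub>M I (\<lambda>i. distr N (S i) (Y i))"
    using X Y M.indep_vars_iff_distr_eq_PiM'[OF I, of X S] N.indep_vars_iff_distr_eq_PiM'[OF I, of Y S]
    by simp_all
  moreover have "Pi\<^sub>M I (\<lambda>i. distr M (S i) (X i)) = Pi\<^sub>M I (\<lambda>i. distr N (S i) (Y i))"
    by (intro PiM_cong law) simp_all
  ultimately show ?thesis by simp
qed

lemma (in prob_space) indep_vars_reindex:
  assumes X: "indep_vars S X K" and f: "inj_on f I" "f \<in> I \<rightarrow> K" and I: "I \<noteq> {}"
  shows "indep_vars (\<lambda>i. S (f i)) (\<lambda>i. X (f i)) I"
proof -
  have rv: "X k \<in> measurable M (S k)" if "k \<in> K" for k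
    using X that by (auto simp: indep_vars_def)
  have K: "K \<noteq> {}" using f I by auto
  let ?D = "\<lambda>k. distr M (S k) (X k)" and ?t = "\<lambda>x. \<lambda>i\<in>I. x (f i)" and ?R = "Pi\<^sub>M I (\<lambda>i. S (f i))"
  have t: "?t \<in> measurable (Pi\<^sub>M K S) ?R"
    using f by (intro measurable_restrict measurable_component_singleton) auto
  have "(\<lambda>\<omega>. \<lambda>k\<in>K. X k \<omega>) \<in> measurable M (Pi\<^sub>M K S)"
    by (intro measurable_restrict rv)
  then have "distr M ?R (\<lambda>\<omega>. \<lambda>i\<in>I. X (f i) \<omega>) = distr (distr M (Pi\<^sub>M K S) (\<lambda>\<omega>. \<lambda>k\<in>K. X k \<omega>)) ?R ?t"
    using f by (subst distr_distr[OF t]) (auto intro!: distr_cong simp: restrict_def fun_eq_iff Pi_iff)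
  also have "\<dots> = distr (Pi\<^sub>M K ?D) ?R ?t"
    using X rv K by (subst indep_vars_iff_distr_eq_PiM'[THEN iffD1]) auto
  also have "\<dots> = distr (Pi\<^sub>M K ?D) (Pi\<^sub>M I (\<lambda>i. ?D (f i))) ?t"
    by (intro distr_cong sets_PiM_cong) auto
  also have "\<dots> = Pi\<^sub>M I (\<lambda>i. ?D (f i))"
    using f rv by (intro distr_PiM_reindex prob_space_distr) auto
  finally show ?thesis
    using f rv by (subst indep_vars_iff_distr_eq_PiM'[OF I]) auto
qed

lemma measurable_restrict_coordinates:
  assumes "\<And>i. i \<in> I \<Longrightarrow> f i \<in> measurable (\<Omega> i) (S i)"
  shows "(\<lambda>\<omega>. \<lambda>i\<in>I. f i (\<omega> i)) \<in> measurable (Pi\<^sub>M I \<Omega>) (Pi\<^sub>M I S)"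
  using assms by (intro measurable_restrict measurable_compose[OF measurable_component_singleton])

lemma expectation_indep_vars_eq_PiM:
  fixes G :: "('i \<Rightarrow> 'c) \<Rightarrow> real"
  assumes M: "prob_space M" and I: "I \<noteq> {}" and X: "prob_space.indep_vars M S X I"
    and \<Omega>: "\<And>i. i \<in> I \<Longrightarrow> prob_space (\<Omega> i)" and f: "\<And>i. i \<in> I \<Longrightarrow> f i \<in> measurable (\<Omega> i) (S i)"
    and law: "\<And>i. i \<in> I \<Longrightarrow> distr M (S i) (X i) = distr (\<Omega> i) (S i) (f i)"
    and G: "G \<in> borel_measurable (Pi\<^sub>M I S)"
  shows "(\<integral>\<omega>. G (\<lambda>i\<in>I. X i \<omega>) \<partial>M) = (\<integral>\<omega>. G (\<lambda>i\<in>I. f i (\<omega> i)) \<partial>Pi\<^sub>M I \<Omega>)"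
proof -
  let ?Q = "Pi\<^sub>M I \<Omega>"
  interpret M: prob_space M by fact
  interpret Q: prob_space ?Q by (rule prob_space_PiM) (rule \<Omega>)
  have Y: "Q.indep_vars S (\<lambda>i \<omega>. f i (\<omega> i)) I"
    by (rule Q.indep_vars_compose2[OF indep_vars_PiM_coordinates[OF \<Omega> I] f])
  have "distr ?Q (S i) (\<lambda>\<omega>. f i (\<omega> i)) = distr (distr ?Q (\<Omega> i) (\<lambda>\<omega>. \<omega> i)) (S i) (f i)" if "i \<in> I" for i
    using distr_distr[OF f[OF that] measurable_component_singleton[OF that, of \<Omega>]] by (simp add: comp_def)
  then have "distr M (S i) (X i) = distr ?Q (S i) (\<lambda>\<omega>. f i (\<omega> i))" if "i \<in> I" for i
    using law \<Omega> that by (simp add: distr_PiM_component)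
  then have "distr M (Pi\<^sub>M I S) (\<lambda>\<omega>. \<lambda>i\<in>I. X i \<omega>) = distr ?Q (Pi\<^sub>M I S) (\<lambda>\<omega>. \<lambda>i\<in>I. f i (\<omega> i))"
    by (rule distr_eq_of_indep_vars[OF M Q.prob_space_axioms I X Y])
  moreover have "(\<lambda>\<omega>. \<lambda>i\<in>I. X i \<omega>) \<in> measurable M (Pi\<^sub>M I S)"
    using X by (auto intro!: measurable_restrict simp: M.indep_vars_def)
  ultimately show ?thesis
    using integral_distr[OF _ G, of "\<lambda>\<omega>. \<lambda>i\<in>I. X i \<omega>" M]
      integral_distr[OF measurable_restrict_coordinates[OF f] G] by simp
qed

context prob_space
begin

definition first_passage :: "(nat \<Rightarrow> 'a \<Rightarrow> real) \<Rightarrow> real \<Rightarrow> nat \<Rightarrow> 'a set" where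
  "first_passage X a k = {\<omega> \<in> space M. a \<le> \<bar>\<Sum>i<k. X i \<omega>\<bar> \<and> (\<forall>j\<in>{..<k}. \<bar>\<Sum>i<j. X i \<omega>\<bar> < a)}"

lemma disjoint_family_first_passage: "disjoint_family (first_passage X a)"
proof (unfold disjoint_family_on_def, intro ballI impI)
  fix i j :: nat assume "i \<noteq> j"
  then consider "i < j" | "j < i" by linarith
  then show "first_passage X a i \<inter> first_passage X a j = {}"
    by cases (force simp: first_passage_def)+
qed

lemma UN_first_passage:
  "(\<Union>k\<le>L. first_passage X a k) = {\<omega> \<in> space M. \<exists>k\<le>L. a \<le> \<bar>\<Sum>i<k. X i \<omega>\<bar>}"
proof (intro equalityI subsetI)
  fix \<omega> assume "\<omega> \<in> {\<omega> \<in> space M. \<exists>k\<le>L. a \<le> \<bar>\<Sum>i<k. X i \<omega>\<bar>}"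
  then obtain k where k: "\<omega> \<in> space M" "k \<le> L" "a \<le> \<bar>\<Sum>i<k. X i \<omega>\<bar>" by auto
  let ?P = "\<lambda>k. a \<le> \<bar>\<Sum>i<k. X i \<omega>\<bar>"
  define k0 where "k0 = (LEAST k. ?P k)"
  have "k0 \<le> L" unfolding k0_def using Least_le[of ?P k, OF k(3)] k(2) by simp
  moreover have "?P k0" unfolding k0_def by (rule LeastI[of ?P k, OF k(3)])
  then have "\<omega> \<in> first_passage X a k0"
    using k(1) not_less_Least[of _ ?P] by (simp add: first_passage_def not_le flip: k0_def)
  ultimately show "\<omega> \<in> (\<Union>k\<le>L. first_passage X a k)" by auto
qed (auto simp: first_passage_def)

lemma first_passage_sets:
  fixes X :: "nat \<Rightarrow> 'a \<Rightarrow> real"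
  assumes X: "\<And>i. i < k \<Longrightarrow> X i \<in> borel_measurable M"
  shows "first_passage X a k \<in> sets M"
proof -
  have sums: "(\<lambda>\<omega>. \<Sum>i<j. X i \<omega>) \<in> borel_measurable M" if "j \<le> k" for j
    using that by (intro borel_measurable_sum X) auto
  show ?thesis
    unfolding first_passage_def
    by (intro sets.sets_Collect_conj sets.sets_Collect_finite_All borel_measurable_le borel_measurable_less
        borel_measurable_abs borel_measurable_const sums) auto
qed

lemma prob_first_passage_inter_increment:
  assumes X: "indep_vars (\<lambda>_. borel) X {..<L}" and k: "k \<le> L"
  shows "prob (first_passage X a k \<inter> {\<omega> \<in> space M. \<bar>\<Sum>i=k..<L. X i \<omega>\<bar> < b})
    = prob (first_passage X a k) * prob {\<omega> \<in> space M. \<bar>\<Sum>i=k..<L. X i \<omega>\<bar> < b}"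
proof -
  let ?A = "\<lambda>\<omega>. \<lambda>i\<in>{..<k}. X i \<omega>" and ?B = "\<lambda>\<omega>. \<lambda>i\<in>{k..<L}. X i \<omega>"
  let ?P = "Pi\<^sub>M {..<k} (\<lambda>_. borel :: real measure)" and ?Q = "Pi\<^sub>M {k..<L} (\<lambda>_. borel :: real measure)"
  let ?E = "{x \<in> space ?P. a \<le> \<bar>\<Sum>i<k. x i\<bar> \<and> (\<forall>j\<in>{..<k}. \<bar>\<Sum>i<j. x i\<bar> < a)}"
  let ?D = "{x \<in> space ?Q. \<bar>\<Sum>i=k..<L. x i\<bar> < b}"
  have indep: "indep_var ?P ?A ?Q ?B"
    using k by (intro indep_var_restrict[OF X]) auto
  have sums: "(\<lambda>x. \<Sum>i<j. x i :: real) \<in> borel_measurable ?P" if "j \<le> k" for j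
    using that by (intro borel_measurable_sum measurable_component_singleton) auto
  have E_sets: "?E \<in> sets ?P"
    by (intro sets.sets_Collect_conj sets.sets_Collect_finite_All borel_measurable_le borel_measurable_less
        borel_measurable_abs borel_measurable_const sums) auto
  have D_sets: "?D \<in> sets ?Q"
    by (intro borel_measurable_less borel_measurable_abs borel_measurable_sum borel_measurable_const
        measurable_component_singleton)
  have "\<bar>\<Sum>i<j. ?A \<omega> i\<bar> = \<bar>\<Sum>i<j. X i \<omega>\<bar>" if "j \<le> k" for j \<omega>
    using that by (intro arg_cong[of _ _ abs] sum.cong) auto
  then have passage: "?A -` ?E \<inter> space M = first_passage X a k"
    by (auto simp: first_passage_def space_PiM)
  have increment: "?B -` ?D \<inter> space M = {\<omega> \<in> space M. \<bar>\<Sum>i=k..<L. X i \<omega>\<bar> < b}"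
    by (auto simp: space_PiM)
  have "(\<lambda>\<omega>. (?A \<omega>, ?B \<omega>)) -` (?E \<times> ?D) \<inter> space M = (?A -` ?E \<inter> space M) \<inter> (?B -` ?D \<inter> space M)"
    by auto
  then show ?thesis
    using indep_varD[OF indep E_sets D_sets] by (simp only: passage increment)
qed

lemma prob_first_passage_le:
  fixes X :: "nat \<Rightarrow> 'a \<Rightarrow> real"
  assumes X: "indep_vars (\<lambda>_. borel) X {..<L}" and k: "k \<le> L"
    and tail: "prob {\<omega> \<in> space M. b \<le> \<bar>\<Sum>i=k..<L. X i \<omega>\<bar>} \<le> c"
  shows "(1 - c) * prob (first_passage X a k)
    \<le> prob (first_passage X a k \<inter> {\<omega> \<in> space M. \<bar>\<Sum>i=k..<L. X i \<omega>\<bar> < b})"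
proof -
  let ?I = "{\<omega> \<in> space M. \<bar>\<Sum>i=k..<L. X i \<omega>\<bar> < b}"
  have "X i \<in> borel_measurable M" if "i < L" for i
    using X that by (auto simp: indep_vars_def)
  then have "(\<lambda>\<omega>. \<Sum>i=k..<L. X i \<omega>) \<in> borel_measurable M"
    by (intro borel_measurable_sum) auto
  moreover have "?I = space M - {\<omega> \<in> space M. b \<le> \<bar>\<Sum>i=k..<L. X i \<omega>\<bar>}" by auto
  ultimately have "prob ?I = 1 - prob {\<omega> \<in> space M. b \<le> \<bar>\<Sum>i=k..<L. X i \<omega>\<bar>}"
    by (simp add: prob_compl)
  with tail have "(1 - c) * prob (first_passage X a k) \<le> prob ?I * prob (first_passage X a k)"
    by (intro mult_right_mono) auto
  then show ?thesis
    by (simp only: prob_first_passage_inter_increment[OF X k] mult.commute)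
qed

theorem Ottaviani_inequality:
  fixes X :: "nat \<Rightarrow> 'a \<Rightarrow> real"
  assumes X: "indep_vars (\<lambda>_. borel) X {..<L}"
    and tail: "\<And>k. k \<le> L \<Longrightarrow> prob {\<omega> \<in> space M. b \<le> \<bar>\<Sum>i=k..<L. X i \<omega>\<bar>} \<le> c"
  shows "(1 - c) * prob {\<omega> \<in> space M. \<exists>k\<le>L. a + b \<le> \<bar>\<Sum>i<k. X i \<omega>\<bar>}
    \<le> prob {\<omega> \<in> space M. a \<le> \<bar>\<Sum>i<L. X i \<omega>\<bar>}"
proof -
  let ?T = "first_passage X (a + b)" and ?I = "\<lambda>k. {\<omega> \<in> space M. \<bar>\<Sum>i=k..<L. X i \<omega>\<bar> < b}"
  have X_meas: "X i \<in> borel_measurable M" if "i < L" for i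
    using X that by (auto simp: indep_vars_def)
  have sum_meas [measurable]: "(\<lambda>\<omega>. \<Sum>i=k..<L. X i \<omega>) \<in> borel_measurable M" for k
    by (intro borel_measurable_sum X_meas) auto
  have T_sets: "?T k \<in> sets M" if "k \<le> L" for k
    using that by (intro first_passage_sets X_meas) auto
  have I_sets: "?I k \<in> sets M" for k by measurable
  have disj: "disjoint_family_on ?T {..L}"
    by (rule disjoint_family_on_mono[OF subset_UNIV disjoint_family_first_passage])
  have "(1 - c) * prob {\<omega> \<in> space M. \<exists>k\<le>L. a + b \<le> \<bar>\<Sum>i<k. X i \<omega>\<bar>} = (\<Sum>k\<le>L. (1 - c) * prob (?T k))"
    unfolding UN_first_passage[symmetric]
    by (subst finite_measure_finite_Union[OF _ _ disj]) (auto simp: sum_distrib_left intro: T_sets)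
  also have "\<dots> \<le> (\<Sum>k\<le>L. prob (?T k \<inter> ?I k))"
    by (intro sum_mono prob_first_passage_le[OF X] tail) auto
  also have "\<dots> = prob (\<Union>k\<le>L. ?T k \<inter> ?I k)"
    using disj T_sets I_sets by (subst finite_measure_finite_Union) (auto simp: disjoint_family_on_def)
  also have "\<dots> \<le> prob {\<omega> \<in> space M. a \<le> \<bar>\<Sum>i<L. X i \<omega>\<bar>}"
  proof (rule finite_measure_mono, rule subsetI)
    fix \<omega> assume "\<omega> \<in> (\<Union>k\<le>L. ?T k \<inter> ?I k)"
    then obtain k where k: "k \<le> L" "\<omega> \<in> ?T k" "\<omega> \<in> ?I k" by auto
    have "(\<Sum>i<L. X i \<omega>) = (\<Sum>i<k. X i \<omega>) + (\<Sum>i=k..<L. X i \<omega>)"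
      using k(1) sum.atLeastLessThan_concat[of 0 k L "\<lambda>i. X i \<omega>"] by (simp add: lessThan_atLeast0)
    then show "\<omega> \<in> {\<omega> \<in> space M. a \<le> \<bar>\<Sum>i<L. X i \<omega>\<bar>}"
      using k by (auto simp: first_passage_def)
  qed (use sum_meas[of 0] in \<open>simp add: lessThan_atLeast0\<close>)
  finally show ?thesis .
qed

end

section \<open>Weak convergence on the line\<close>

definition Skorohod_coupling ::
    "(nat \<Rightarrow> real measure) \<Rightarrow> real measure \<Rightarrow> real measure \<Rightarrow> (nat \<Rightarrow> real \<Rightarrow> real) \<Rightarrow> (real \<Rightarrow> real) \<Rightarrow> bool" where
  "Skorohod_coupling \<mu> N \<Omega> W Y \<longleftrightarrow> prob_space \<Omega> \<and>
     (\<forall>n. W n \<in> borel_measurable \<Omega> \<and> distr \<Omega> borel (W n) = \<mu> n) \<and>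
     Y \<in> borel_measurable \<Omega> \<and> distr \<Omega> borel Y = N \<and> (\<forall>x\<in>space \<Omega>. (\<lambda>n. W n x) \<longlonglongrightarrow> Y x)"

lemma Skorohod_couplingD:
  assumes "Skorohod_coupling \<mu> N \<Omega> W Y"
  shows "prob_space \<Omega>" "W n \<in> borel_measurable \<Omega>" "distr \<Omega> borel (W n) = \<mu> n"
    "Y \<in> borel_measurable \<Omega>" "distr \<Omega> borel Y = N" "x \<in> space \<Omega> \<Longrightarrow> (\<lambda>n. W n x) \<longlonglongrightarrow> Y x"
  using assms by (auto simp: Skorohod_coupling_def)

lemma Skorohod_coupling_exists:
  assumes "\<And>n. real_distribution (\<mu> n)" "real_distribution N" "weak_conv_m \<mu> N"
  shows "\<exists>\<Omega> W Y. Skorohod_coupling \<mu> N \<Omega> W Y"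
  using Skorohod[OF assms] unfolding Skorohod_coupling_def measurable_lborel1 by blast

lemma weak_conv_m_compose:
  "weak_conv_m \<mu> N \<Longrightarrow> filterlim f sequentially sequentially \<Longrightarrow> weak_conv_m (\<lambda>n. \<mu> (f n)) N"
  unfolding weak_conv_m_def weak_conv_def by (auto intro: filterlim_compose)

lemma weak_conv_m_scale:
  assumes \<mu>: "\<And>n. real_distribution (\<mu> n)" and N: "real_distribution N" and conv: "weak_conv_m \<mu> N"
    and c: "c \<longlonglongrightarrow> c'"
  shows "weak_conv_m (\<lambda>n. distr (\<mu> n) borel (\<lambda>x. c n * x)) (distr N borel (\<lambda>x. c' * x))"
proof -
  obtain \<Omega> W Y where coupling: "Skorohod_coupling \<mu> N \<Omega> W Y"
    using Skorohod_coupling_exists[OF \<mu> N conv] by blast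
  note [measurable] = Skorohod_couplingD(2,4)[OF coupling] and law = Skorohod_couplingD(3,5)[OF coupling]
    and lim = Skorohod_couplingD(6)[OF coupling]
  interpret prob_space \<Omega> by (rule Skorohod_couplingD(1)[OF coupling])
  have law_scaled: "distr (\<mu> n) borel (\<lambda>x. c n * x) = distr \<Omega> borel (\<lambda>x. c n * W n x)"
    "distr N borel (\<lambda>x. c' * x) = distr \<Omega> borel (\<lambda>x. c' * Y x)" for n
    unfolding law[symmetric] by (simp_all add: distr_distr comp_def)
  show ?thesis
    unfolding law_scaled
  proof (rule integral_bdd_continuous_conv_imp_weak_conv)
    fix f :: "real \<Rightarrow> real" assume f: "\<And>x. isCont f x" "\<And>x. \<bar>f x\<bar> \<le> 1"
    then have [measurable]: "f \<in> borel_measurable borel"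
      by (intro borel_measurable_continuous_onI continuous_at_imp_continuous_on) auto
    have "(\<lambda>n. expectation (\<lambda>x. f (c n * W n x))) \<longlonglongrightarrow> expectation (\<lambda>x. f (c' * Y x))"
      by (rule integral_dominated_convergence[where w = "\<lambda>_. 1"])
        (auto simp: f intro!: isCont_tendsto_compose[OF f(1)] tendsto_mult c lim)
    then show "(\<lambda>n. integral\<^sup>L (distr \<Omega> borel (\<lambda>x. c n * W n x)) f)
        \<longlonglongrightarrow> integral\<^sup>L (distr \<Omega> borel (\<lambda>x. c' * Y x)) f"
      by (simp add: integral_distr)
  qed (auto intro!: real_distribution_distr)
qed

lemma weak_conv_m_eventually_tail_less:
  assumes \<mu>: "\<And>n. real_distribution (\<mu> n)" and N: "real_distribution N" and conv: "weak_conv_m \<mu> N"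
    and a: "a > 0" and int: "integrable N (\<lambda>x. \<bar>x\<bar> ^ p)" and moment: "(\<integral>x. \<bar>x\<bar> ^ p \<partial>N) < \<delta> * a ^ p"
  shows "\<forall>\<^sub>F n in sequentially. measure (\<mu> n) {x. a \<le> \<bar>x\<bar>} < \<delta>"
proof -
  interpret N: real_distribution N by fact
  define g where "g x = min 1 ((\<bar>x\<bar> / a) ^ p)" for x
  have g: "isCont g x" "\<bar>g x\<bar> \<le> 1" "0 \<le> g x" for x
    unfolding g_def using a by (auto intro!: continuous_intros)
  have [measurable]: "g \<in> borel_measurable borel" unfolding g_def[abs_def] by measurable
  have "integral\<^sup>L N g \<le> (\<integral>x. \<bar>x\<bar> ^ p / a ^ p \<partial>N)"
  proof (rule integral_mono)
    show "integrable N g" using g(2) by (intro N.integrable_const_bound[where B = 1]) auto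
  qed (use int in \<open>auto simp: g_def power_divide\<close>)
  also have "\<dots> < \<delta>" using moment a by (simp add: field_simps)
  finally have "integral\<^sup>L N g < \<delta>" .
  moreover have "(\<lambda>n. integral\<^sup>L (\<mu> n) g) \<longlonglongrightarrow> integral\<^sup>L N g"
    using g(1,2) by (intro weak_conv_imp_integral_bdd_continuous_conv[OF \<mu> N conv, where B = 1]) auto
  ultimately have "\<forall>\<^sub>F n in sequentially. integral\<^sup>L (\<mu> n) g < \<delta>"
    by (intro order_tendstoD)
  then show ?thesis
  proof eventually_elim
    case (elim n)
    interpret real_distribution "\<mu> n" by (rule \<mu>)
    have "prob {x. a \<le> \<bar>x\<bar>} = expectation (indicator {x. a \<le> \<bar>x\<bar>})" by simp
    also have "\<dots> \<le> expectation g"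
    proof (rule integral_mono)
      show "integrable (\<mu> n) g" using g(2) by (intro integrable_const_bound[where B = 1]) auto
      show "indicator {x. a \<le> \<bar>x\<bar>} x \<le> g x" for x
        using a g(3)[of x] by (auto simp: indicator_def g_def one_le_power)
    qed (simp add: emeasure_eq_measure)
    finally show ?case using elim by simp
  qed
qed

theorem expectation_indep_vars_tendsto:
  fixes G :: "('i \<Rightarrow> real) \<Rightarrow> real"
  assumes P: "\<And>n. prob_space (P n)" and M: "prob_space M" and I: "I \<noteq> {}"
    and X: "\<And>n. prob_space.indep_vars (P n) (\<lambda>_. borel) (X n) I"
    and Z: "prob_space.indep_vars M (\<lambda>_. borel) Z I"
    and conv: "\<And>i. i \<in> I \<Longrightarrow> weak_conv_m (\<lambda>n. distr (P n) borel (X n i)) (distr M borel (Z i))"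
    and G: "G \<in> borel_measurable (Pi\<^sub>M I (\<lambda>_. borel))" and bounded: "\<And>x. \<bar>G x\<bar> \<le> C"
    and cont: "\<And>x y. (\<And>i. i \<in> I \<Longrightarrow> (\<lambda>n. x n i) \<longlonglongrightarrow> y i) \<Longrightarrow> (\<lambda>n. G (x n)) \<longlonglongrightarrow> G y"
  shows "(\<lambda>n. \<integral>\<omega>. G (\<lambda>i\<in>I. X n i \<omega>) \<partial>P n) \<longlonglongrightarrow> (\<integral>\<omega>. G (\<lambda>i\<in>I. Z i \<omega>) \<partial>M)"
proof -
  have "\<exists>\<Omega> W Y. Skorohod_coupling (\<lambda>n. distr (P n) borel (X n i)) (distr M borel (Z i)) \<Omega> W Y"
    if i: "i \<in> I" for i
    using X Z i P M by (intro Skorohod_coupling_exists conv)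
      (auto intro!: prob_space.real_distribution_distr simp: prob_space.indep_vars_def)
  then obtain \<Omega> W Y where coupling:
    "\<And>i. i \<in> I \<Longrightarrow> Skorohod_coupling (\<lambda>n. distr (P n) borel (X n i)) (distr M borel (Z i)) (\<Omega> i) (W i) (Y i)"
    by metis
  note \<Omega> = Skorohod_couplingD(1)[OF coupling] and W = Skorohod_couplingD(2)[OF coupling]
    and law_W = Skorohod_couplingD(3)[OF coupling] and Y = Skorohod_couplingD(4)[OF coupling]
    and law_Y = Skorohod_couplingD(5)[OF coupling] and lim = Skorohod_couplingD(6)[OF coupling]
  interpret Q: prob_space "Pi\<^sub>M I \<Omega>" by (rule prob_space_PiM) (rule \<Omega>)
  note G_meas = measurable_compose[OF measurable_restrict_coordinates G]
  have "(\<lambda>n. Q.expectation (\<lambda>\<omega>. G (\<lambda>i\<in>I. W i n (\<omega> i)))) \<longlonglongrightarrow> Q.expectation (\<lambda>\<omega>. G (\<lambda>i\<in>I. Y i (\<omega> i)))"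
  proof (rule integral_dominated_convergence[where w = "\<lambda>_. C"])
    show "AE \<omega> in Pi\<^sub>M I \<Omega>. (\<lambda>n. G (\<lambda>i\<in>I. W i n (\<omega> i))) \<longlonglongrightarrow> G (\<lambda>i\<in>I. Y i (\<omega> i))"
    proof (intro AE_I2 cont)
      fix \<omega> i assume "\<omega> \<in> space (Pi\<^sub>M I \<Omega>)" "i \<in> I"
      with lim[of i "\<omega> i"] show "(\<lambda>n. (\<lambda>i\<in>I. W i n (\<omega> i)) i) \<longlonglongrightarrow> (\<lambda>i\<in>I. Y i (\<omega> i)) i"
        by (simp add: space_PiM PiE_iff)
    qed
  qed (auto intro: G_meas W Y simp: bounded)
  moreover have "(\<integral>\<omega>. G (\<lambda>i\<in>I. X n i \<omega>) \<partial>P n) = Q.expectation (\<lambda>\<omega>. G (\<lambda>i\<in>I. W i n (\<omega> i)))" for n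
    by (rule expectation_indep_vars_eq_PiM[OF P I X \<Omega> W law_W[symmetric] G])
  moreover have "(\<integral>\<omega>. G (\<lambda>i\<in>I. Z i \<omega>) \<partial>M) = Q.expectation (\<lambda>\<omega>. G (\<lambda>i\<in>I. Y i (\<omega> i)))"
    by (rule expectation_indep_vars_eq_PiM[OF M I Z \<Omega> Y law_Y[symmetric] G])
  ultimately show ?thesis by simp
qed

corollary weak_conv_C01_poly_path_indep_vars:
  assumes "\<And>n. prob_space (P n)" "prob_space M" "m > 0"
    and "\<And>n. prob_space.indep_vars (P n) (\<lambda>_. borel) (X n) {..<m}"
    and "prob_space.indep_vars M (\<lambda>_. borel) Z {..<m}"
    and "\<And>j. j < m \<Longrightarrow> weak_conv_m (\<lambda>n. distr (P n) borel (X n j)) (distr M borel (Z j))"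
  shows "weak_conv_C01 P (\<lambda>n \<omega>. poly_path m (\<lambda>j. X n j \<omega>)) M (\<lambda>\<omega>. poly_path m (\<lambda>j. Z j \<omega>))"
  unfolding weak_conv_C01_def
proof (intro allI impI)
  fix F assume F: "bounded_continuous_functional_C01 F"
  then obtain C where C: "\<And>g. continuous_on {0..1} g \<Longrightarrow> \<bar>F g\<bar> \<le> C"
    using bounded_continuous_functional_C01_bounded[OF F] by blast
  have restrict: "poly_path m (\<lambda>i\<in>{..<m}. x i) = poly_path m x" for x
    by (rule poly_path_cong) simp
  have "random_path_C01 (Pi\<^sub>M {..<m} (\<lambda>_. borel)) (\<lambda>x. poly_path m (\<lambda>j. x j))"
    by (intro random_path_C01_poly_path measurable_component_singleton) auto
  then have "(\<lambda>n. \<integral>\<omega>. F (poly_path m (\<lambda>j\<in>{..<m}. X n j \<omega>)) \<partial>P n)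
      \<longlonglongrightarrow> (\<integral>\<omega>. F (poly_path m (\<lambda>j\<in>{..<m}. Z j \<omega>)) \<partial>M)"
    using assms F by (intro expectation_indep_vars_tendsto[where C = C])
      (auto intro: C continuous_on_poly_path functional_C01_poly_path_tendsto random_path_C01_measurable)
  then show "(\<lambda>n. \<integral>\<omega>. F (poly_path m (\<lambda>j. X n j \<omega>)) \<partial>P n) \<longlonglongrightarrow> (\<integral>\<omega>. F (poly_path m (\<lambda>j. Z j \<omega>)) \<partial>M)"
    by (simp only: restrict)
qed

section \<open>Donsker's theorem\<close>

lemma block_sum_eq_sum: "block_sum m n x j = (\<Sum>i\<in>{grid m n j..<grid m n (Suc j)}. x i)"
  using sum.shift_bounds_nat_ivl[of x 0 "grid m n j" "block_length m n j"]
  by (simp add: block_sum_def grid_Suc lessThan_atLeast0 add.commute)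

lemma grid_over_n_tendsto:
  assumes m: "m > 0"
  shows "(\<lambda>n. real (grid m n j) / real n) \<longlonglongrightarrow> real j / real m"
proof (rule real_tendsto_sandwich)
  show "\<forall>\<^sub>F n in sequentially. real j / real m - 1 / real n \<le> real (grid m n j) / real n"
    using eventually_gt_at_top[of 0]
  proof eventually_elim
    case (elim n)
    have "j * n < m * (grid m n j + 1)"
      using m unfolding grid_def by (simp add: dividend_less_times_div)
    then have "real (j * n) \<le> real (m * (grid m n j + 1))" by (simp only: of_nat_le_iff less_imp_le)
    then have "real j / real m \<le> (real (grid m n j) + 1) / real n" using m elim by (simp add: field_simps)
    then show ?case by (simp add: add_divide_distrib)
  qed
  show "\<forall>\<^sub>F n in sequentially. real (grid m n j) / real n \<le> real j / real m"
    using eventually_gt_at_top[of 0]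
  proof eventually_elim
    case (elim n)
    have "real (m * grid m n j) \<le> real (j * n)"
      by (simp only: of_nat_le_iff grid_def times_div_less_eq_dividend)
    then show ?case using m elim by (simp add: field_simps)
  qed
  show "(\<lambda>n. real j / real m - 1 / real n) \<longlonglongrightarrow> real j / real m"
    using tendsto_diff[OF tendsto_const lim_1_over_n] by simp
qed simp

lemma block_length_over_n_tendsto:
  assumes "m > 0"
  shows "(\<lambda>n. real (block_length m n j) / real n) \<longlonglongrightarrow> 1 / real m"
proof -
  have "(\<lambda>n. real (grid m n (Suc j)) / real n - real (grid m n j) / real n)
      \<longlonglongrightarrow> real (Suc j) / real m - real j / real m"
    by (intro tendsto_diff grid_over_n_tendsto assms)
  moreover have "real (block_length m n j) = real (grid m n (Suc j)) - real (grid m n j)" for n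
    by (simp add: grid_Suc)
  ultimately show ?thesis by (simp add: diff_divide_distrib add_divide_distrib)
qed

lemma filterlim_block_length:
  assumes m: "m > 0"
  shows "filterlim (\<lambda>n. block_length m n j) sequentially sequentially"
proof -
  have "filterlim (\<lambda>n. real (block_length m n j) / real n * real n) at_top sequentially"
    using m filterlim_real_sequentially
    by (intro filterlim_tendsto_pos_mult_at_top[OF block_length_over_n_tendsto[OF m]]) simp_all
  moreover have "real (block_length m n j) / real n * real n = real (block_length m n j)" for n
    by (cases "n = 0") (simp_all add: block_length_def grid_def)
  ultimately show ?thesis
    by (simp only: filterlim_sequentially_iff_filterlim_real)
qed

lemma block_length_le:
  assumes "0 < m" "m \<le> n"
  shows "real m * real (block_length m n j) \<le> 2 * real n"
proof -
  have "m * grid m n (Suc j) \<le> Suc j * n"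
    unfolding grid_def by (rule times_div_less_eq_dividend)
  moreover have "j * n < m * (grid m n j + 1)"
    using assms unfolding grid_def by (simp add: dividend_less_times_div)
  ultimately have "m * block_length m n j \<le> 2 * n" using assms by (simp add: grid_Suc algebra_simps)
  then show ?thesis by (simp flip: of_nat_mult)
qed

lemma distr_std_normal_scale:
  assumes c: "c > 0"
  shows "distr std_normal_distribution borel (\<lambda>x. c * x) = density lborel (normal_density 0 c)"
proof -
  interpret N: prob_space std_normal_distribution by (rule prob_space_normal_density) simp
  have "distributed std_normal_distribution lborel (\<lambda>x. x) std_normal_density"
    unfolding distributed_def by (simp add: distr_id2)
  then have "distributed std_normal_distribution lborel (\<lambda>x. 0 + c * x)
      (normal_density (0 + c * 0) (\<bar>c\<bar> * 1))"
    using c by (intro N.normal_density_affine) auto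
  then show ?thesis
    using c by (simp add: distributed_distr_eq_density[symmetric] cong: distr_cong)
qed

lemma normal_fourth_moment:
  assumes s: "s > 0"
  shows "integrable (density lborel (normal_density 0 s)) (\<lambda>x. \<bar>x\<bar> ^ 4)"
    and "(\<integral>x. \<bar>x\<bar> ^ 4 \<partial>density lborel (normal_density 0 s)) = 3 * s ^ 4"
proof -
  show "integrable (density lborel (normal_density 0 s)) (\<lambda>x. \<bar>x\<bar> ^ 4)"
    using integrable_normal_moment_abs[OF s, of 0 4] by (simp add: integrable_density normal_density_nonneg)
  show "(\<integral>x. \<bar>x\<bar> ^ 4 \<partial>density lborel (normal_density 0 s)) = 3 * s ^ 4"
    using integral_normal_moment_even[OF s, of 0 2] s
    by (simp add: integral_density normal_density_nonneg eval_nat_numeral field_simps)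
qed

locale iid_centered_sequence = prob_space +
  fixes X :: "nat \<Rightarrow> 'a \<Rightarrow> real" and \<sigma> :: real
  assumes indep: "indep_vars (\<lambda>_. borel) X UNIV"
    and identically_distributed: "\<And>i j. distr M borel (X i) = distr M borel (X j)"
    and square_integrable: "\<And>i. integrable M (\<lambda>\<omega>. (X i \<omega>)\<^sup>2)"
    and mean_zero: "\<And>i. expectation (X i) = 0"
    and second_moment: "\<And>i. expectation (\<lambda>\<omega>. (X i \<omega>)\<^sup>2) = \<sigma>\<^sup>2"
    and \<sigma>_pos: "\<sigma> > 0"
begin

lemma X_measurable [measurable]: "X i \<in> borel_measurable M"
  using indep by (auto simp: indep_vars_def)

lemma integrable_X: "integrable M (X i)"
  by (rule square_integrable_imp_integrable[OF X_measurable square_integrable])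

lemma iid_centered_sequence_shift: "iid_centered_sequence M (\<lambda>i. X (a + i)) \<sigma>"
proof
  show "indep_vars (\<lambda>_. borel) (\<lambda>i. X (a + i)) UNIV"
    using indep_vars_reindex[OF indep, of "\<lambda>i. a + i" UNIV] by simp
qed (rule identically_distributed square_integrable mean_zero second_moment \<sigma>_pos)+

lemma distr_sum_shift:
  "distr M borel (\<lambda>\<omega>. \<Sum>i<L. X (a + i) \<omega>) = distr M borel (\<lambda>\<omega>. \<Sum>i<L. X i \<omega>)"
proof (rule Levy_uniqueness)
  interpret shift: iid_centered_sequence M "\<lambda>i. X (a + i)" \<sigma> by (rule iid_centered_sequence_shift)
  show "char (distr M borel (\<lambda>\<omega>. \<Sum>i<L. X (a + i) \<omega>)) = char (distr M borel (\<lambda>\<omega>. \<Sum>i<L. X i \<omega>))"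
  proof
    fix t
    have "char (distr M borel (X (a + i))) t = char (distr M borel (X i)) t" for i
      by (simp only: identically_distributed[of "a + i" i])
    then show "char (distr M borel (\<lambda>\<omega>. \<Sum>i<L. X (a + i) \<omega>)) t = char (distr M borel (\<lambda>\<omega>. \<Sum>i<L. X i \<omega>)) t"
      using char_distr_sum[OF indep_vars_subset[OF indep subset_UNIV]]
        char_distr_sum[OF indep_vars_subset[OF shift.indep subset_UNIV]] by simp
  qed
qed (auto intro: real_distribution_distr)

lemma square_sum_moment:
  assumes "finite A"
  shows "integrable M (\<lambda>\<omega>. (\<Sum>i\<in>A. X i \<omega>)\<^sup>2)" "expectation (\<lambda>\<omega>. (\<Sum>i\<in>A. X i \<omega>)\<^sup>2) = real (card A) * \<sigma>\<^sup>2"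
  using assms
proof (induction A)
  case (insert x F)
  have "indep_var borel (X x) borel (\<lambda>\<omega>. \<Sum>i\<in>F. X i \<omega>)"
    using insert.hyps by (intro indep_vars_sum indep_vars_subset[OF indep]) auto
  then have cross: "integrable M (\<lambda>\<omega>. X x \<omega> * (\<Sum>i\<in>F. X i \<omega>))"
    "expectation (\<lambda>\<omega>. X x \<omega> * (\<Sum>i\<in>F. X i \<omega>)) = 0"
    using indep_var_integrable[of "X x" "\<lambda>\<omega>. \<Sum>i\<in>F. X i \<omega>"]
      indep_var_lebesgue_integral[of "X x" "\<lambda>\<omega>. \<Sum>i\<in>F. X i \<omega>"]
    by (auto simp: integrable_X mean_zero)
  have expand: "(\<Sum>i\<in>insert x F. X i \<omega>)\<^sup>2 = (X x \<omega>)\<^sup>2 + 2 * (X x \<omega> * (\<Sum>i\<in>F. X i \<omega>)) + (\<Sum>i\<in>F. X i \<omega>)\<^sup>2" for \<omega>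
    using insert.hyps by (simp add: power2_sum)
  show "integrable M (\<lambda>\<omega>. (\<Sum>i\<in>insert x F. X i \<omega>)\<^sup>2)"
    unfolding expand using cross insert.IH square_integrable by auto
  show "expectation (\<lambda>\<omega>. (\<Sum>i\<in>insert x F. X i \<omega>)\<^sup>2) = real (card (insert x F)) * \<sigma>\<^sup>2"
    unfolding expand using cross insert square_integrable by (simp add: second_moment algebra_simps)
qed simp_all

lemma prob_abs_sum_ge_le:
  assumes "finite A" "b > 0"
  shows "prob {\<omega> \<in> space M. b \<le> \<bar>\<Sum>i\<in>A. X i \<omega>\<bar>} \<le> real (card A) * \<sigma>\<^sup>2 / b\<^sup>2"
  using second_moment_method[of "\<lambda>\<omega>. \<Sum>i\<in>A. X i \<omega>", where a = b]
    square_sum_moment[OF assms(1)] assms(2) by simp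

lemma maximal_inequality:
  assumes "a > 0" "2 * real L * \<sigma>\<^sup>2 \<le> a\<^sup>2"
  shows "prob {\<omega> \<in> space M. \<exists>k\<le>L. 2 * a \<le> \<bar>\<Sum>i<k. X i \<omega>\<bar>} \<le> 2 * prob {\<omega> \<in> space M. a \<le> \<bar>\<Sum>i<L. X i \<omega>\<bar>}"
proof -
  have "prob {\<omega> \<in> space M. a \<le> \<bar>\<Sum>i=k..<L. X i \<omega>\<bar>} \<le> 1 / 2" for k
  proof -
    have "prob {\<omega> \<in> space M. a \<le> \<bar>\<Sum>i=k..<L. X i \<omega>\<bar>} \<le> real (card {k..<L}) * \<sigma>\<^sup>2 / a\<^sup>2"
      using assms(1) by (intro prob_abs_sum_ge_le) auto
    also have "\<dots> \<le> real L * \<sigma>\<^sup>2 / a\<^sup>2"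
      by (intro divide_right_mono mult_right_mono) auto
    also have "\<dots> \<le> 1 / 2" using assms by (simp add: divide_le_eq)
    finally show ?thesis .
  qed
  from Ottaviani_inequality[OF indep_vars_subset[OF indep subset_UNIV] this, where a = a] show ?thesis
    by simp
qed

abbreviation block :: "nat \<Rightarrow> nat \<Rightarrow> nat \<Rightarrow> 'a \<Rightarrow> real" where
  "block m n j \<omega> \<equiv> block_sum m n (\<lambda>i. X i \<omega> / sqrt (real n)) j"

lemma block_measurable [measurable]: "block m n j \<in> borel_measurable M"
  unfolding block_sum_def by measurable

lemma indep_vars_block: "indep_vars (\<lambda>_. borel) (block m n) UNIV"
proof -
  let ?K = "\<lambda>j. {grid m n j..<grid m n (Suc j)}"
  have disj: "disjoint_family ?K"
  proof (unfold disjoint_family_on_def, intro ballI impI)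
    fix i j :: nat assume "i \<noteq> j"
    then have "grid m n (Suc i) \<le> grid m n j \<or> grid m n (Suc j) \<le> grid m n i"
      by (metis Suc_leI grid_mono linorder_neqE_nat)
    then show "?K i \<inter> ?K j = {}" by auto
  qed
  have "indep_vars (\<lambda>j. Pi\<^sub>M (?K j) (\<lambda>_. borel)) (\<lambda>j \<omega>. \<lambda>i\<in>?K j. X i \<omega>) UNIV"
    by (rule indep_vars_restrict[OF indep _ disj]) auto
  then have "indep_vars (\<lambda>_. borel) (\<lambda>j \<omega>. \<Sum>i\<in>?K j. (\<lambda>i\<in>?K j. X i \<omega>) i / sqrt (real n)) UNIV"
    by (rule indep_vars_compose2[where Y = "\<lambda>j x. \<Sum>i\<in>?K j. x i / sqrt (real n)"])
      (auto intro!: borel_measurable_sum borel_measurable_divide measurable_component_singleton)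
  then show ?thesis by (simp add: block_sum_eq_sum)
qed

lemma distr_block:
  "distr M borel (block m n j) = distr M borel (\<lambda>\<omega>. (\<Sum>i<block_length m n j. X i \<omega>) / sqrt (real n))"
proof -
  have "distr M borel (block m n j)
      = distr (distr M borel (\<lambda>\<omega>. \<Sum>i<block_length m n j. X (grid m n j + i) \<omega>))
          borel (\<lambda>x. x / sqrt (real n))"
    by (subst distr_distr) (auto simp: comp_def block_sum_def sum_divide_distrib)
  also have "\<dots> = distr M borel (\<lambda>\<omega>. (\<Sum>i<block_length m n j. X i \<omega>) / sqrt (real n))"
    unfolding distr_sum_shift by (subst distr_distr) (auto simp: comp_def)
  finally show ?thesis .
qed

lemma block_clt:
  assumes m: "m > 0"
  shows "weak_conv_m (\<lambda>n. distr M borel (block m n j))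
    (density lborel (normal_density 0 (\<sigma> / sqrt (real m))))"
proof -
  let ?L = "\<lambda>n. block_length m n j" and ?c = "\<lambda>n. sqrt (real (block_length m n j) / real n * \<sigma>\<^sup>2)"
  let ?\<mu> = "\<lambda>L. distr M borel (\<lambda>\<omega>. (\<Sum>i<L. X i \<omega>) / sqrt (real L * \<sigma>\<^sup>2))"
  have "weak_conv_m ?\<mu> std_normal_distribution"
    by (rule central_limit_theorem_zero_mean[where \<mu> = "distr M borel (X 0)"])
      (auto intro: indep mean_zero \<sigma>_pos square_integrable identically_distributed
        simp: mean_zero second_moment)
  then have "weak_conv_m (\<lambda>n. ?\<mu> (?L n)) std_normal_distribution"
    by (rule weak_conv_m_compose[OF _ filterlim_block_length[OF m]])
  moreover have "?c \<longlonglongrightarrow> sqrt (1 / real m * \<sigma>\<^sup>2)"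
    by (intro tendsto_intros block_length_over_n_tendsto m)
  ultimately have "weak_conv_m (\<lambda>n. distr (?\<mu> (?L n)) borel (\<lambda>x. ?c n * x))
      (distr std_normal_distribution borel (\<lambda>x. sqrt (1 / real m * \<sigma>\<^sup>2) * x))"
    by (intro weak_conv_m_scale) (auto intro: real_distribution_distr real_dist_normal_dist)
  moreover have "distr (?\<mu> (?L n)) borel (\<lambda>x. ?c n * x) = distr M borel (block m n j)" for n
    unfolding distr_block using \<sigma>_pos
    by (subst distr_distr) (auto simp: comp_def real_sqrt_divide real_sqrt_mult intro!: distr_cong)
  moreover have "sqrt (1 / real m * \<sigma>\<^sup>2) = \<sigma> / sqrt (real m)" "\<sigma> / sqrt (real m) > 0"
    using \<sigma>_pos m by (simp_all add: real_sqrt_divide)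
  ultimately show ?thesis by (simp only: distr_std_normal_scale)
qed

lemma prob_block_oscillation_le:
  assumes m: "0 < m" "m \<le> n" and a: "a > 0" "4 * \<sigma>\<^sup>2 \<le> real m * a\<^sup>2"
  shows "prob {\<omega> \<in> space M. \<exists>k\<le>block_length m n j. 2 * a \<le> \<bar>\<Sum>i<k. X (grid m n j + i) \<omega> / sqrt (real n)\<bar>}
    \<le> 2 * measure (distr M borel (block m n j)) {x. a \<le> \<bar>x\<bar>}"
proof -
  interpret shift: iid_centered_sequence M "\<lambda>i. X (grid m n j + i)" \<sigma> by (rule iid_centered_sequence_shift)
  let ?L = "block_length m n j" and ?S = "\<lambda>k \<omega>. \<Sum>i<k. X (grid m n j + i) \<omega>"
  have n: "sqrt (real n) > 0" using m by simp
  have scale: "b \<le> \<bar>\<Sum>i<k. X (grid m n j + i) \<omega> / sqrt (real n)\<bar> \<longleftrightarrow> b * sqrt (real n) \<le> \<bar>?S k \<omega>\<bar>" for b k \<omega>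
    using n by (simp add: sum_divide_distrib[symmetric] abs_divide pos_le_divide_eq)
  have "real m * (2 * real ?L * \<sigma>\<^sup>2) \<le> 4 * \<sigma>\<^sup>2 * real n"
    using mult_right_mono[OF block_length_le[OF m, of j], of "2 * \<sigma>\<^sup>2"] by (simp add: algebra_simps)
  also have "\<dots> \<le> real m * a\<^sup>2 * real n" using a by (intro mult_right_mono) auto
  finally have "2 * real ?L * \<sigma>\<^sup>2 \<le> (a * sqrt (real n))\<^sup>2"
    using m by (simp add: power_mult_distrib mult.assoc)
  then have "prob {\<omega> \<in> space M. \<exists>k\<le>?L. 2 * (a * sqrt (real n)) \<le> \<bar>?S k \<omega>\<bar>}
      \<le> 2 * prob {\<omega> \<in> space M. a * sqrt (real n) \<le> \<bar>?S ?L \<omega>\<bar>}"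
    using a n by (intro shift.maximal_inequality) auto
  also have "{\<omega> \<in> space M. a * sqrt (real n) \<le> \<bar>?S ?L \<omega>\<bar>} = block m n j -` {x. a \<le> \<bar>x\<bar>} \<inter> space M"
    by (auto simp: block_sum_def scale)
  also have "prob \<dots> = measure (distr M borel (block m n j)) {x. a \<le> \<bar>x\<bar>}"
    by (rule measure_distr[symmetric]) simp_all
  finally show ?thesis by (simp only: scale mult.assoc)
qed

text \<open>The fourth moment bounds the tail of each of the $m$ blocks by $O(1/m^2)$, so that the sum of
  the tails still vanishes as $m \to \infty$; the second moment would not suffice.\<close>

lemma eventually_block_tail_less:
  assumes m: "m > 0" and a: "a > 0" and \<delta>: "3 * \<sigma> ^ 4 < \<delta> * (real m)\<^sup>2 * a ^ 4"
  shows "\<forall>\<^sub>F n in sequentially. measure (distr M borel (block m n j)) {x. a \<le> \<bar>x\<bar>} < \<delta>"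
proof (rule weak_conv_m_eventually_tail_less[OF _ _ block_clt[OF m] a])
  have s: "\<sigma> / sqrt (real m) > 0" using m \<sigma>_pos by simp
  show "real_distribution (density lborel (normal_density 0 (\<sigma> / sqrt (real m))))"
    using prob_space_normal_density[OF s] by (simp add: real_distribution_def real_distribution_axioms_def)
  show "integrable (density lborel (normal_density 0 (\<sigma> / sqrt (real m)))) (\<lambda>x. \<bar>x\<bar> ^ 4)"
    by (rule normal_fourth_moment(1)[OF s])
  have "3 * (\<sigma> / sqrt (real m)) ^ 4 = 3 * \<sigma> ^ 4 / (real m)\<^sup>2"
    by (simp add: power_divide power4_eq_xxxx power2_eq_square)
  also have "\<dots> < \<delta> * a ^ 4" using m \<delta> by (simp add: field_simps)
  finally show "(\<integral>x. \<bar>x\<bar> ^ 4 \<partial>density lborel (normal_density 0 (\<sigma> / sqrt (real m)))) < \<delta> * a ^ 4"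
    by (simp only: normal_fourth_moment(2)[OF s])
qed (auto intro: real_distribution_distr)

lemma eventually_prob_block_oscillation_le:
  assumes a: "a > 0" and \<epsilon>: "\<epsilon> > 0"
  shows "\<forall>\<^sub>F m in sequentially. \<forall>\<^sub>F n in sequentially. prob (\<Union>j<m. {\<omega> \<in> space M.
    \<exists>k\<le>block_length m n j. 2 * a \<le> \<bar>\<Sum>i<k. X (grid m n j + i) \<omega> / sqrt (real n)\<bar>}) \<le> \<epsilon>"
proof -
  have "\<forall>\<^sub>F m in sequentially. 4 * \<sigma>\<^sup>2 / a\<^sup>2 \<le> real m \<and> 6 * \<sigma> ^ 4 / (\<epsilon> * a ^ 4) < real m \<and> 0 < m"
    by (intro eventually_conj eventually_gt_at_top
        eventually_compose_filterlim[OF eventually_ge_at_top filterlim_real_sequentially]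
        eventually_compose_filterlim[OF eventually_gt_at_top filterlim_real_sequentially])
  then show ?thesis
  proof eventually_elim
    case (elim m)
    then have m: "0 < m" and m_square: "4 * \<sigma>\<^sup>2 \<le> real m * a\<^sup>2"
      and m_moment: "6 * \<sigma> ^ 4 < real m * (\<epsilon> * a ^ 4)"
      using a \<epsilon> by (simp_all add: divide_le_eq divide_less_eq)
    let ?E = "\<lambda>n j. {\<omega> \<in> space M.
      \<exists>k\<le>block_length m n j. 2 * a \<le> \<bar>\<Sum>i<k. X (grid m n j + i) \<omega> / sqrt (real n)\<bar>}"
    let ?tail = "\<lambda>n j. measure (distr M borel (block m n j)) {x. a \<le> \<bar>x\<bar>}"
    have "3 * \<sigma> ^ 4 < \<epsilon> / (2 * real m) * (real m)\<^sup>2 * a ^ 4"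
      using m m_moment by (simp add: field_simps power2_eq_square)
    then have "\<forall>\<^sub>F n in sequentially. \<forall>j\<in>{..<m}. ?tail n j < \<epsilon> / (2 * real m)"
      using m a by (intro eventually_ball_finite ballI eventually_block_tail_less) auto
    then show ?case
      using eventually_ge_at_top[of m]
    proof eventually_elim
      case (elim n)
      have "prob (\<Union>j<m. ?E n j) \<le> (\<Sum>j<m. prob (?E n j))"
        by (rule finite_measure_subadditive_finite) auto
      also have "\<dots> \<le> (\<Sum>j<m. 2 * ?tail n j)"
        by (intro sum_mono prob_block_oscillation_le m elim(2) a m_square)
      also have "\<dots> \<le> (\<Sum>j<m. 2 * (\<epsilon> / (2 * real m)))"
        using elim(1) by (intro sum_mono mult_left_mono less_imp_le) auto
      also have "\<dots> = \<epsilon>" using m by simp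
      finally show ?case .
    qed
  qed
qed

lemma eventually_close_block_path:
  assumes \<eta>: "\<eta> > 0" and \<epsilon>: "\<epsilon> > 0"
  shows "\<forall>\<^sub>F m in sequentially. \<forall>\<^sub>F n in sequentially. uniformly_close_in_prob M
    (\<lambda>\<omega>. rescaled_path n (\<lambda>i. X i \<omega>)) (\<lambda>\<omega>. poly_path m (\<lambda>j. block m n j \<omega>)) \<eta> \<epsilon>"
proof -
  have "\<eta> / 6 > 0" using \<eta> by simp
  from eventually_prob_block_oscillation_le[OF this \<epsilon>] eventually_gt_at_top[of 0] show ?thesis
  proof eventually_elim
    case (elim m)
    from elim(1) eventually_ge_at_top[of m] show ?case
    proof eventually_elim
      case (elim n)
      let ?E = "\<lambda>j. {\<omega> \<in> space M.
        \<exists>k\<le>block_length m n j. 2 * (\<eta> / 6) \<le> \<bar>\<Sum>i<k. X (grid m n j + i) \<omega> / sqrt (real n)\<bar>}"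
      have "sup_dist (rescaled_path n (\<lambda>i. X i \<omega>)) (poly_path m (\<lambda>j. block m n j \<omega>)) \<le> \<eta>"
        if \<omega>: "\<omega> \<in> space M - (\<Union>j<m. ?E j)" for \<omega>
      proof -
        have "\<bar>\<Sum>i<k. X (grid m n j + i) \<omega> / sqrt (real n)\<bar> \<le> \<eta> / 3"
          if "j < m" "k \<le> block_length m n j" for j k
          using \<omega> that by force
        from sup_dist_poly_path_block_sum_le[OF \<open>0 < m\<close> elim(2) this] show ?thesis by simp
      qed
      with elim(1) show ?case
        unfolding uniformly_close_in_prob_def by (intro bexI[of _ "\<Union>j<m. ?E j"]) auto
    qed
  qed
qed

end

lemma standard_BM_01D:
  assumes "standard_BM_01 M B"
  shows "prob_space M" "\<omega> \<in> space M \<Longrightarrow> B \<omega> 0 = 0" "\<omega> \<in> space M \<Longrightarrow> continuous_on {0..1} (B \<omega>)"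
    "0 \<le> s \<Longrightarrow> s < t \<Longrightarrow> t \<le> 1 \<Longrightarrow> distributed M lborel (\<lambda>\<omega>. B \<omega> t - B \<omega> s) (normal_density 0 (sqrt (t - s)))"
    "ts 0 \<ge> 0 \<Longrightarrow> ts k \<le> 1 \<Longrightarrow> (\<And>i. i < k \<Longrightarrow> ts i < ts (Suc i)) \<Longrightarrow>
      prob_space.indep_vars M (\<lambda>_. borel) (\<lambda>i \<omega>. B \<omega> (ts (Suc i)) - B \<omega> (ts i)) {..<k}"
  using assms unfolding standard_BM_01_def by blast+

lemma standard_BM_01_measurable:
  assumes B: "standard_BM_01 M B" and t: "t \<in> {0..1}"
  shows "(\<lambda>\<omega>. B \<omega> t) \<in> borel_measurable M"
proof (cases "t = 0")
  case True
  then show ?thesis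
    by (subst measurable_cong[of _ _ "\<lambda>_. 0"]) (auto simp: standard_BM_01D(2)[OF B])
next
  case False
  with t have "(\<lambda>\<omega>. B \<omega> t - B \<omega> 0) \<in> borel_measurable M"
    using distributed_measurable[OF standard_BM_01D(4)[OF B, of 0 t]] by simp
  then show ?thesis
    by (subst measurable_cong[of _ _ "\<lambda>\<omega>. B \<omega> t - B \<omega> 0"]) (auto simp: standard_BM_01D(2)[OF B])
qed

lemma random_path_C01_scaled_BM:
  assumes B: "standard_BM_01 M B"
  shows "random_path_C01 M (\<lambda>\<omega> t. c * B \<omega> t)"
  using standard_BM_01D(2,3)[OF B] standard_BM_01_measurable[OF B]
  by (intro random_path_C01I) (auto intro: continuous_on_mult_left)

lemma scaled_BM_increment:
  assumes B: "standard_BM_01 M B" and c: "c > 0" and j: "j < m"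
  shows "distr M borel (\<lambda>\<omega>. c * B \<omega> (real (Suc j) / real m) - c * B \<omega> (real j / real m))
    = density lborel (normal_density 0 (c / sqrt (real m)))"
proof -
  interpret prob_space M by (rule standard_BM_01D[OF B])
  have "distributed M lborel (\<lambda>\<omega>. B \<omega> (real (Suc j) / real m) - B \<omega> (real j / real m))
      (normal_density 0 (sqrt (real (Suc j) / real m - real j / real m)))"
    using j by (intro standard_BM_01D[OF B]) (auto simp: divide_strict_right_mono)
  moreover have "real (Suc j) / real m - real j / real m = 1 / real m"
    by (simp flip: diff_divide_distrib)
  ultimately have "distributed M lborel (\<lambda>\<omega>. 0 + c * (B \<omega> (real (Suc j) / real m) - B \<omega> (real j / real m)))
      (normal_density (0 + c * 0) (\<bar>c\<bar> * sqrt (1 / real m)))"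
    using c j by (intro normal_density_affine) auto
  then show ?thesis
    using c by (simp add: distributed_distr_eq_density[symmetric] right_diff_distrib real_sqrt_divide
        cong: distr_cong)
qed

lemma indep_vars_scaled_BM_increments:
  assumes B: "standard_BM_01 M B" and m: "m > 0"
  shows "prob_space.indep_vars M (\<lambda>_. borel)
    (\<lambda>j \<omega>. c * B \<omega> (real (Suc j) / real m) - c * B \<omega> (real j / real m)) {..<m}"
proof -
  interpret prob_space M by (rule standard_BM_01D[OF B])
  have "indep_vars (\<lambda>_. borel) (\<lambda>j \<omega>. B \<omega> (real (Suc j) / real m) - B \<omega> (real j / real m)) {..<m}"
    using m standard_BM_01D(5)[OF B, of "\<lambda>i. real i / real m" m] by (auto simp: divide_strict_right_mono)
  then have "indep_vars (\<lambda>_. borel)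
      (\<lambda>j \<omega>. c * (B \<omega> (real (Suc j) / real m) - B \<omega> (real j / real m))) {..<m}"
    by (rule indep_vars_compose2) auto
  then show ?thesis by (simp add: right_diff_distrib)
qed

theorem (in iid_centered_sequence) Donsker:
  assumes B: "standard_BM_01 N B"
  shows "weak_conv_C01 (\<lambda>_. M) (\<lambda>n \<omega>. rescaled_path n (\<lambda>i. X i \<omega>)) N (\<lambda>\<omega> t. \<sigma> * B \<omega> t)"
proof (rule weak_conv_C01_double_limit)
  let ?Z = "\<lambda>m \<omega>. interpolation m (\<lambda>t. \<sigma> * B \<omega> t)"
  have path: "random_path_C01 N (\<lambda>\<omega> t. \<sigma> * B \<omega> t)" by (rule random_path_C01_scaled_BM[OF B])
  show "\<forall>\<^sub>F m in sequentially. weak_conv_C01 (\<lambda>_. M) (\<lambda>n \<omega>. poly_path m (\<lambda>j. block m n j \<omega>)) N (?Z m)"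
    using eventually_gt_at_top[of 0]
  proof eventually_elim
    case (elim m)
    then show ?case
      unfolding interpolation_def
      by (intro weak_conv_C01_poly_path_indep_vars prob_space_axioms standard_BM_01D(1)[OF B]
          indep_vars_scaled_BM_increments[OF B] indep_vars_subset[OF indep_vars_block subset_UNIV])
        (simp_all only: scaled_BM_increment[OF B \<sigma>_pos] block_clt)
  qed
  show "weak_conv_C01 (\<lambda>_. N) ?Z N (\<lambda>\<omega> t. \<sigma> * B \<omega> t)"
  proof (rule weak_conv_C01_pointwise[OF standard_BM_01D(1)[OF B] _ path])
    show "random_path_C01 N (?Z m)" for m
      using standard_BM_01_measurable[OF B] by (intro random_path_C01_interpolation) auto
    show "(\<lambda>m. sup_dist (?Z m \<omega>) (\<lambda>t. \<sigma> * B \<omega> t)) \<longlonglongrightarrow> 0" if "\<omega> \<in> space N" for \<omega>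
      using standard_BM_01D(2)[OF B that] random_path_C01_continuous[OF path that]
      by (intro sup_dist_interpolation_tendsto) auto
  qed
  show "random_path_C01 N (\<lambda>\<omega> t. \<sigma> * B \<omega> t)" by (rule path)
qed (auto intro!: standard_BM_01D(1)[OF B] prob_space_axioms random_path_C01_poly_path
    eventually_close_block_path)

section \<open>Ranks of independent random variables\<close>

definition rank_perm :: "nat \<Rightarrow> (nat \<Rightarrow> real) \<Rightarrow> nat \<Rightarrow> nat" where
  "rank_perm n v a = (if a \<in> {1..n} then card {b \<in> {1..n}. v b \<le> v a} else a)"

lemma rank_perm_cong: "(\<And>a. a \<in> {1..n} \<Longrightarrow> v a = w a) \<Longrightarrow> rank_perm n v = rank_perm n w"
  by (auto simp: rank_perm_def fun_eq_iff intro!: arg_cong[of _ _ card])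

lemma rank_perm_less_iff:
  assumes "a \<in> {1..n}" "b \<in> {1..n}"
  shows "rank_perm n v a < rank_perm n v b \<longleftrightarrow> v a < v b"
proof (cases "v a < v b")
  case True
  then have "{c \<in> {1..n}. v c \<le> v a} \<subseteq> {c \<in> {1..n}. v c \<le> v b}" by auto
  moreover have "b \<in> {c \<in> {1..n}. v c \<le> v b}" "b \<notin> {c \<in> {1..n}. v c \<le> v a}" using True assms by auto
  ultimately have "{c \<in> {1..n}. v c \<le> v a} \<subset> {c \<in> {1..n}. v c \<le> v b}" by blast
  then show ?thesis using True assms by (simp add: rank_perm_def psubset_card_mono)
next
  case False
  then have "card {c \<in> {1..n}. v c \<le> v b} \<le> card {c \<in> {1..n}. v c \<le> v a}" by (intro card_mono) auto
  then show ?thesis using False assms by (simp add: rank_perm_def)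
qed

lemma rank_perm_permutes:
  assumes v: "inj_on v {1..n}"
  shows "rank_perm n v permutes {1..n}"
proof (rule inj_imp_permutes)
  show "inj_on (rank_perm n v) {1..n}"
  proof (rule inj_onI)
    fix a b assume ab: "a \<in> {1..n}" "b \<in> {1..n}" "rank_perm n v a = rank_perm n v b"
    with rank_perm_less_iff[of a n b v] rank_perm_less_iff[of b n a v] have "v a = v b" by auto
    with v ab show "a = b" by (auto dest: inj_onD)
  qed
  show "rank_perm n v a \<in> {1..n}" if a: "a \<in> {1..n}" for a
  proof -
    have "card {a} \<le> card {b \<in> {1..n}. v b \<le> v a}" using a by (intro card_mono) auto
    moreover have "card {b \<in> {1..n}. v b \<le> v a} \<le> card {1..n}" by (intro card_mono) auto
    ultimately show ?thesis using a by (simp add: rank_perm_def)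
  qed
qed (auto simp: rank_perm_def)

lemma rank_perm_comp:
  assumes \<sigma>: "\<sigma> permutes {1..n}"
  shows "rank_perm n (v \<circ> \<sigma>) = rank_perm n v \<circ> \<sigma>"
proof
  fix a
  have "\<sigma> ` {b \<in> {1..n}. v (\<sigma> b) \<le> v (\<sigma> a)} = {b \<in> {1..n}. v b \<le> v (\<sigma> a)}"
    by (subst (2) permutes_image[OF \<sigma>, symmetric]) auto
  then have "card {b \<in> {1..n}. v (\<sigma> b) \<le> v (\<sigma> a)} = card {b \<in> {1..n}. v b \<le> v (\<sigma> a)}"
    using card_image[OF permutes_inj_on[OF \<sigma>]] by metis
  then show "rank_perm n (v \<circ> \<sigma>) a = (rank_perm n v \<circ> \<sigma>) a"
    using permutes_in_image[OF \<sigma>, of a] permutes_not_in[OF \<sigma>, of a] by (simp add: rank_perm_def)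
qed

context
  fixes N :: "real measure"
  assumes N: "prob_space N" and sets_N [measurable_cong]: "sets N = sets borel"
begin

lemma measurable_PiM_coordinate: "i \<in> I \<Longrightarrow> (\<lambda>v. v i) \<in> borel_measurable (Pi\<^sub>M I (\<lambda>_. N))"
  by (simp add: measurable_component_singleton measurable_cong_sets[OF refl sets_N, symmetric])

lemma measurable_rank_perm: "rank_perm n \<in> measurable (Pi\<^sub>M {1..n} (\<lambda>_. N)) (count_space UNIV)"
proof -
  let ?Q = "Pi\<^sub>M {1..n} (\<lambda>_. N)" and ?S = "{1..n} \<times> {1..n}"
  define below where "below v = {(a, b) \<in> ?S. v b \<le> v a}" for v :: "nat \<Rightarrow> real"
  have "below \<in> measurable ?Q (count_space (Pow ?S))"
  proof (subst measurable_count_space_eq2, simp, intro conjI ballI)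
    fix R assume "R \<in> Pow ?S"
    then have "below -` {R} \<inter> space ?Q = {v \<in> space ?Q. \<forall>p\<in>?S. v (snd p) \<le> v (fst p) \<longleftrightarrow> p \<in> R}"
      by (force simp: below_def)
    also have "\<dots> \<in> sets ?Q"
    proof (intro sets.sets_Collect_finite_All)
      fix p assume "p \<in> ?S"
      then have "{v \<in> space ?Q. v (snd p) \<le> v (fst p)} \<in> sets ?Q"
        by (intro borel_measurable_le measurable_PiM_coordinate) auto
      then show "{v \<in> space ?Q. v (snd p) \<le> v (fst p) \<longleftrightarrow> p \<in> R} \<in> sets ?Q"
        by (cases "p \<in> R") (auto intro: sets.sets_Collect_neg)
    qed simp
    finally show "below -` {R} \<inter> space ?Q \<in> sets ?Q" .
  qed (auto simp: below_def)
  then have "(\<lambda>v a. if a \<in> {1..n} then card {b. (a, b) \<in> below v} else a)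
      \<in> measurable ?Q (count_space UNIV)"
    by (rule measurable_compose) simp
  moreover have "rank_perm n = (\<lambda>v a. if a \<in> {1..n} then card {b. (a, b) \<in> below v} else a)"
    by (auto simp: rank_perm_def below_def fun_eq_iff intro!: arg_cong[of _ _ card])
  ultimately show ?thesis by simp
qed

lemma AE_PiM_coordinates_distinct:
  assumes atomless: "\<And>x. emeasure N {x} = 0" and ij: "i \<in> I" "j \<in> I" "i \<noteq> j"
  shows "AE v in Pi\<^sub>M I (\<lambda>_. N). v i \<noteq> v j"
proof -
  let ?Q = "Pi\<^sub>M I (\<lambda>_. N)"
  interpret N: prob_space N by (rule N)
  interpret Q: prob_space ?Q by (rule prob_space_PiM) (rule N)
  interpret pair: pair_prob_space N N by unfold_locales
  have "Q.indep_vars (\<lambda>_. N) (\<lambda>i v. v i) I"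
    using ij N by (intro indep_vars_PiM_coordinates) auto
  from Q.indep_var_restrict[OF this, of "{i}" "{j}"] ij
  have "Q.indep_var N ((\<lambda>v. v i) \<circ> (\<lambda>v. \<lambda>k\<in>{i}. v k)) N ((\<lambda>v. v j) \<circ> (\<lambda>v. \<lambda>k\<in>{j}. v k))"
    by (intro Q.indep_var_compose measurable_component_singleton) auto
  then have "Q.indep_var N (\<lambda>v. v i) N (\<lambda>v. v j)"
    by (simp add: comp_def)
  moreover have "distr ?Q N (\<lambda>v. v k) = N" if "k \<in> I" for k
    using distr_PiM_component[of I "\<lambda>_. N" k] N that by simp
  ultimately have law: "distr ?Q (N \<Otimes>\<^sub>M N) (\<lambda>v. (v i, v j)) = N \<Otimes>\<^sub>M N"
    using ij by (simp add: Q.indep_var_distribution_eq)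
  have "AE p in N \<Otimes>\<^sub>M N. fst p \<noteq> snd p"
  proof (rule pair.AE_pair_measure)
    show "{p \<in> space (N \<Otimes>\<^sub>M N). fst p \<noteq> snd p} \<in> sets (N \<Otimes>\<^sub>M N)" by measurable
    have "AE y in N. x \<noteq> y" for x
      using atomless[of x] sets_N by (intro AE_I[of _ _ "{x}"]) auto
    then show "AE x in N. AE y in N. fst (x, y) \<noteq> snd (x, y)" by simp
  qed
  then have "AE p in distr ?Q (N \<Otimes>\<^sub>M N) (\<lambda>v. (v i, v j)). fst p \<noteq> snd p" by (simp only: law)
  then show ?thesis
    using ij by (subst (asm) AE_distr_iff) (auto intro!: measurable_Pair measurable_component_singleton)
qed

lemma AE_rank_perm_permutes:
  assumes "\<And>x. emeasure N {x} = 0"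
  shows "AE v in Pi\<^sub>M {1..n} (\<lambda>_. N). rank_perm n v permutes {1..n}"
proof -
  have "AE v in Pi\<^sub>M {1..n} (\<lambda>_. N). \<forall>i\<in>{1..n}. \<forall>j\<in>{1..n}. i \<noteq> j \<longrightarrow> v i \<noteq> v j"
    by (intro AE_finite_allI) (auto intro: AE_PiM_coordinates_distinct assms)
  then show ?thesis
  proof eventually_elim
    case (elim v)
    then show ?case by (intro rank_perm_permutes) (auto simp: inj_on_def)
  qed
qed

lemma expectation_rank_perm_comp:
  fixes h :: "(nat \<Rightarrow> nat) \<Rightarrow> real"
  assumes \<sigma>: "\<sigma> permutes {1..n}"
  shows "(\<integral>v. h (rank_perm n v \<circ> \<sigma>) \<partial>Pi\<^sub>M {1..n} (\<lambda>_. N)) = (\<integral>v. h (rank_perm n v) \<partial>Pi\<^sub>M {1..n} (\<lambda>_. N))"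
proof -
  let ?Q = "Pi\<^sub>M {1..n} (\<lambda>_. N)" and ?T = "\<lambda>v. \<lambda>i\<in>{1..n}. v (\<sigma> i)"
  have T: "?T \<in> measurable ?Q ?Q"
    using permutes_in_image[OF \<sigma>] by (intro measurable_restrict measurable_component_singleton) auto
  have meas: "(\<lambda>v. h (rank_perm n v)) \<in> borel_measurable ?Q"
    by (rule measurable_compose[OF measurable_rank_perm]) simp
  have "rank_perm n v \<circ> \<sigma> = rank_perm n (?T v)" for v
    unfolding rank_perm_comp[OF \<sigma>, symmetric] by (rule rank_perm_cong) simp
  then have "(\<integral>v. h (rank_perm n v \<circ> \<sigma>) \<partial>?Q) = (\<integral>v. h (rank_perm n v) \<partial>distr ?Q ?Q ?T)"
    by (simp only: integral_distr[OF T meas])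
  also have "distr ?Q ?Q ?T = ?Q"
    using permutes_in_image[OF \<sigma>] N by (intro distr_PiM_reindex permutes_inj_on[OF \<sigma>]) auto
  finally show ?thesis .
qed

text \<open>The law of the rank permutation does not change when it is composed with a fixed permutation,
  and averaging over all these compositions makes it uniform.\<close>

theorem expectation_rank_perm:
  fixes h :: "(nat \<Rightarrow> nat) \<Rightarrow> real"
  assumes atomless: "\<And>x. emeasure N {x} = 0"
  shows "(\<integral>v. h (rank_perm n v) \<partial>Pi\<^sub>M {1..n} (\<lambda>_. N))
    = measure_pmf.expectation (pmf_of_set {\<sigma>. \<sigma> permutes {1..n}}) h"
proof -
  let ?Q = "Pi\<^sub>M {1..n} (\<lambda>_. N)" and ?P = "{\<sigma>. \<sigma> permutes {1..n}}"
  interpret Q: prob_space ?Q by (rule prob_space_PiM) (rule N)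
  have fin: "finite ?P" by (rule finite_permutations) simp
  have ne: "?P \<noteq> {}" using permutes_id by blast
  note perm = AE_rank_perm_permutes[OF atomless, of n]
  have meas: "(\<lambda>v. h (rank_perm n v \<circ> \<sigma>)) \<in> borel_measurable ?Q" for \<sigma>
    by (rule measurable_compose[OF measurable_rank_perm]) simp
  have int: "integrable ?Q (\<lambda>v. h (rank_perm n v \<circ> \<sigma>))" if \<sigma>: "\<sigma> \<in> ?P" for \<sigma>
  proof (rule Q.integrable_const_bound[OF _ meas])
    show "AE v in ?Q. norm (h (rank_perm n v \<circ> \<sigma>)) \<le> (\<Sum>\<rho>\<in>?P. \<bar>h \<rho>\<bar>)"
      using perm
    proof eventually_elim
      case (elim v)
      then have "rank_perm n v \<circ> \<sigma> \<in> ?P" using \<sigma> by (auto intro: permutes_compose)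
      then show ?case using fin by (simp add: member_le_sum[of _ _ "\<lambda>\<rho>. \<bar>h \<rho>\<bar>"])
    qed
  qed
  have "real (card ?P) * Q.expectation (\<lambda>v. h (rank_perm n v))
      = (\<Sum>\<sigma>\<in>?P. Q.expectation (\<lambda>v. h (rank_perm n v \<circ> \<sigma>)))"
    by (simp add: expectation_rank_perm_comp del: One_nat_def)
  also have "\<dots> = Q.expectation (\<lambda>v. \<Sum>\<sigma>\<in>?P. h (rank_perm n v \<circ> \<sigma>))"
    using int by simp
  also have "\<dots> = Q.expectation (\<lambda>v. \<Sum>\<sigma>\<in>?P. h \<sigma>)"
  proof (rule integral_cong_AE)
    show "AE v in ?Q. (\<Sum>\<sigma>\<in>?P. h (rank_perm n v \<circ> \<sigma>)) = (\<Sum>\<sigma>\<in>?P. h \<sigma>)"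
      using perm by eventually_elim (rule setum_permutations_compose_left[symmetric])
  qed (use meas in auto)
  finally show ?thesis
    using fin ne by (simp add: integral_pmf_of_set Q.prob_space field_simps del: One_nat_def)
qed

end

section \<open>Partial sums of uniform variables modulo 1\<close>

definition unif :: "real measure" where
  "unif = uniform_measure lborel {0..1}"

lemma sets_unif [simp, measurable_cong]: "sets unif = sets borel"
  by (simp add: unif_def)

interpretation unif: prob_space unif
  unfolding unif_def by (rule prob_space_uniform_measure) auto

interpretation unif_product: product_prob_space "\<lambda>_. unif" I for I :: "nat set"
  by unfold_locales

lemma emeasure_unif_singleton: "emeasure unif {x} = 0"
proof -
  have "emeasure lborel ({0..1} \<inter> {x}) \<le> emeasure lborel {x}" by (intro emeasure_mono) auto
  then show ?thesis by (simp add: unif_def)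
qed

lemma AE_unif: "AE u in unif. 0 \<le> u \<and> u < 1"
  unfolding unif_def
proof (rule AE_uniform_measureI)
  show "AE u in lborel. u \<in> {0..1} \<longrightarrow> 0 \<le> u \<and> u < (1::real)"
    using AE_lborel_singleton[of "1::real"] by eventually_elim auto
qed simp

lemma nn_integral_unif:
  assumes "f \<in> borel_measurable borel"
  shows "(\<integral>\<^sup>+u. f u \<partial>unif) = (\<integral>\<^sup>+u. f u * indicator {0..<1} u \<partial>lborel)"
proof -
  have "(\<integral>\<^sup>+u. f u \<partial>unif) = (\<integral>\<^sup>+u. f u * indicator {0..1} u \<partial>lborel)"
    using assms by (simp add: unif_def nn_integral_uniform_measure divide_ennreal_def)
  also have "\<dots> = (\<integral>\<^sup>+u. f u * indicator {0..<1} u \<partial>lborel)"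
  proof (rule nn_integral_cong_AE)
    show "AE u in lborel. f u * indicator {0..1} u = f u * indicator {0..<1} u"
      using AE_lborel_singleton[of "1::real"] by eventually_elim (auto simp: indicator_def)
  qed
  finally show ?thesis .
qed

lemma nn_integral_unif_frac_shift:
  assumes [measurable]: "f \<in> borel_measurable borel"
  shows "(\<integral>\<^sup>+u. f (frac (a + u)) \<partial>unif) = (\<integral>\<^sup>+u. f u \<partial>unif)"
proof -
  define c where "c = frac a"
  have c: "0 \<le> c" "c < 1" by (auto simp: c_def frac_lt_1)
  have [measurable]: "frac \<in> borel_measurable (borel :: real measure)"
    unfolding frac_def[abs_def] by measurable
  have shift: "frac (a + u) = (if u < 1 - c then c + u else c - 1 + u)" if "u \<in> {0..<1}" for u
    using that by (auto simp: frac_add c_def frac_eq)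
  have "(\<integral>\<^sup>+u. f (frac (a + u)) \<partial>unif) = (\<integral>\<^sup>+u. f (frac (a + u)) * indicator {0..<1} u \<partial>lborel)"
    by (rule nn_integral_unif) measurable
  also have "\<dots> = (\<integral>\<^sup>+u. f (c + 1 * u) * indicator {c..<1} (c + 1 * u)
      + f (c - 1 + 1 * u) * indicator {0..<c} (c - 1 + 1 * u) \<partial>lborel)"
    using c by (intro nn_integral_cong) (auto simp: indicator_def shift)
  also have "\<dots> = (\<integral>\<^sup>+u. f (c + 1 * u) * indicator {c..<1} (c + 1 * u) \<partial>lborel)
      + (\<integral>\<^sup>+u. f (c - 1 + 1 * u) * indicator {0..<c} (c - 1 + 1 * u) \<partial>lborel)"
    by (rule nn_integral_add) measurable
  also have "\<dots> = (\<integral>\<^sup>+u. f u * indicator {c..<1} u \<partial>lborel) + (\<integral>\<^sup>+u. f u * indicator {0..<c} u \<partial>lborel)"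
    using nn_integral_real_affine[of "\<lambda>u. f u * indicator {c..<1} u" 1 c]
      nn_integral_real_affine[of "\<lambda>u. f u * indicator {0..<c} u" 1 "c - 1"] by simp
  also have "\<dots> = (\<integral>\<^sup>+u. f u * indicator {c..<1} u + f u * indicator {0..<c} u \<partial>lborel)"
    by (rule nn_integral_add[symmetric]) measurable
  also have "\<dots> = (\<integral>\<^sup>+u. f u * indicator {0..<1} u \<partial>lborel)"
    using c by (intro nn_integral_cong) (auto simp: indicator_def)
  also have "\<dots> = (\<integral>\<^sup>+u. f u \<partial>unif)"
    by (rule nn_integral_unif[symmetric]) measurable
  finally show ?thesis .
qed

definition frac_sums :: "nat \<Rightarrow> (nat \<Rightarrow> real) \<Rightarrow> nat \<Rightarrow> real" where
  "frac_sums n u = (\<lambda>i\<in>{1..n}. frac (\<Sum>j=1..i. u j))"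

lemma measurable_frac_sums:
  assumes "{1..n} \<subseteq> I"
  shows "frac_sums n \<in> measurable (Pi\<^sub>M I (\<lambda>_. unif)) (Pi\<^sub>M {1..n} (\<lambda>_. unif))"
  unfolding frac_sums_def
proof (rule measurable_restrict)
  fix i assume i: "i \<in> {1..n}"
  have "(\<lambda>u. \<Sum>j=1..i. u j) \<in> borel_measurable (Pi\<^sub>M I (\<lambda>_. unif))"
    using i assms by (intro borel_measurable_sum measurable_PiM_coordinate unif.prob_space_axioms) auto
  moreover have "frac \<in> borel_measurable (borel :: real measure)"
    unfolding frac_def[abs_def] by measurable
  ultimately have "(\<lambda>u. frac (\<Sum>j=1..i. u j)) \<in> borel_measurable (Pi\<^sub>M I (\<lambda>_. unif))"
    by (rule measurable_compose)
  then show "(\<lambda>u. frac (\<Sum>j=1..i. u j)) \<in> measurable (Pi\<^sub>M I (\<lambda>_. unif)) unif"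
    by (simp cong: measurable_cong_sets)
qed

lemma frac_sums_Suc:
  "frac_sums (Suc n) (u(Suc n := y)) = (frac_sums n u)(Suc n := frac ((\<Sum>j=1..n. u j) + y))"
proof
  fix i
  have "(\<Sum>j=1..k. (u(Suc n := y)) j) = (\<Sum>j=1..k. u j)" if "k \<le> n" for k
    using that by (intro sum.cong) auto
  then show "frac_sums (Suc n) (u(Suc n := y)) i = ((frac_sums n u)(Suc n := frac ((\<Sum>j=1..n. u j) + y))) i"
    by (auto simp: frac_sums_def le_Suc_eq)
qed

lemma nn_integral_PiM_unif_Suc:
  assumes "f \<in> borel_measurable (Pi\<^sub>M {1..Suc n} (\<lambda>_. unif))"
  shows "(\<integral>\<^sup>+u. f u \<partial>Pi\<^sub>M {1..Suc n} (\<lambda>_. unif))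
    = (\<integral>\<^sup>+u. \<integral>\<^sup>+y. f (u(Suc n := y)) \<partial>unif \<partial>Pi\<^sub>M {1..n} (\<lambda>_. unif))"
  using unif_product.product_nn_integral_insert[of "{1..n}" "Suc n" f] assms
  by (simp add: atLeastAtMostSuc_conv)

lemma nn_integral_frac_sums:
  assumes "f \<in> borel_measurable (Pi\<^sub>M {1..n} (\<lambda>_. unif))"
  shows "(\<integral>\<^sup>+u. f (frac_sums n u) \<partial>Pi\<^sub>M {1..n} (\<lambda>_. unif)) = (\<integral>\<^sup>+u. f u \<partial>Pi\<^sub>M {1..n} (\<lambda>_. unif))"
  using assms
proof (induction n arbitrary: f)
  case 0
  have "frac_sums 0 u = u" if "u \<in> space (Pi\<^sub>M {1..0} (\<lambda>_. unif))" for u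
    using that by (auto simp: frac_sums_def space_PiM)
  then show ?case by (intro nn_integral_cong) simp
next
  case (Suc n)
  let ?Q = "Pi\<^sub>M {1..n} (\<lambda>_. unif)" and ?Q' = "Pi\<^sub>M {1..Suc n} (\<lambda>_. unif)"
  have "(\<lambda>(u, y). u(Suc n := y)) \<in> measurable (?Q \<Otimes>\<^sub>M unif) ?Q'"
    using measurable_add_dim[of "Suc n" "{1..n}" "\<lambda>_. unif"] by (simp add: atLeastAtMostSuc_conv)
  from measurable_compose[OF this Suc.prems]
  have joint: "(\<lambda>(u, y). f (u(Suc n := y))) \<in> borel_measurable (?Q \<Otimes>\<^sub>M unif)"
    by (simp add: case_prod_beta' fun_upd_def)
  have inner: "(\<lambda>u. \<integral>\<^sup>+y. f (u(Suc n := y)) \<partial>unif) \<in> borel_measurable ?Q"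
    using joint by (rule unif.borel_measurable_nn_integral)
  have fibre: "(\<lambda>y. f (u(Suc n := y))) \<in> borel_measurable borel" if "u \<in> space ?Q" for u
    using measurable_compose[OF measurable_Pair1'[OF that] joint] by (simp cong: measurable_cong_sets)
  have "(\<integral>\<^sup>+u. f (frac_sums (Suc n) u) \<partial>?Q')
      = (\<integral>\<^sup>+u. \<integral>\<^sup>+y. f ((frac_sums n u)(Suc n := frac ((\<Sum>j=1..n. u j) + y))) \<partial>unif \<partial>?Q)"
    using nn_integral_PiM_unif_Suc[OF measurable_compose[OF measurable_frac_sums[OF subset_refl] Suc.prems]]
    by (simp only: frac_sums_Suc)
  also have "\<dots> = (\<integral>\<^sup>+u. \<integral>\<^sup>+y. f ((frac_sums n u)(Suc n := y)) \<partial>unif \<partial>?Q)"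
    by (intro nn_integral_cong nn_integral_unif_frac_shift fibre
        measurable_space[OF measurable_frac_sums[OF subset_refl]])
  also have "\<dots> = (\<integral>\<^sup>+u. \<integral>\<^sup>+y. f (u(Suc n := y)) \<partial>unif \<partial>?Q)"
    by (rule Suc.IH[OF inner])
  also have "\<dots> = (\<integral>\<^sup>+u. f u \<partial>?Q')"
    by (rule nn_integral_PiM_unif_Suc[OF Suc.prems, symmetric])
  finally show ?case .
qed

lemma distr_frac_sums:
  "distr (Pi\<^sub>M {1..n} (\<lambda>_. unif)) (Pi\<^sub>M {1..n} (\<lambda>_. unif)) (frac_sums n) = Pi\<^sub>M {1..n} (\<lambda>_. unif)"
  (is "distr ?Q ?Q _ = ?Q")
proof (rule measure_eqI)
  fix A assume "A \<in> sets (distr ?Q ?Q (frac_sums n))"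
  then have A: "A \<in> sets ?Q" by simp
  have "emeasure (distr ?Q ?Q (frac_sums n)) A = (\<integral>\<^sup>+u. indicator A (frac_sums n u) \<partial>?Q)"
    using A nn_integral_distr[OF measurable_frac_sums[OF subset_refl], of "indicator A" n] by simp
  also have "\<dots> = emeasure ?Q A"
    using A by (subst nn_integral_frac_sums) auto
  finally show "emeasure (distr ?Q ?Q (frac_sums n)) A = emeasure ?Q A" .
qed simp

text \<open>Permutations act on \<open>{1..n}\<close>, so that coordinate 0 of a sequence is never used.\<close>

definition unif_seq :: "(nat \<Rightarrow> real) measure" where
  "unif_seq = Pi\<^sub>M UNIV (\<lambda>_. unif)"

interpretation unif_seq: prob_space unif_seq
  unfolding unif_seq_def by (rule prob_space_PiM) (rule unif.prob_space_axioms)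

lemma measurable_unif_seq_coordinate [measurable]: "(\<lambda>\<omega>. \<omega> i) \<in> borel_measurable unif_seq"
  unfolding unif_seq_def by (rule measurable_PiM_coordinate[OF unif.prob_space_axioms]) simp_all

lemma AE_unif_seq: "AE \<omega> in unif_seq. \<forall>i. 0 \<le> \<omega> i \<and> \<omega> i < 1"
proof -
  have "AE \<omega> in unif_seq. 0 \<le> \<omega> i \<and> \<omega> i < 1" for i
    unfolding unif_seq_def
    using AE_PiM_component[of UNIV "\<lambda>_. unif" i] AE_unif unif.prob_space_axioms by blast
  then show ?thesis by (simp add: AE_all_countable)
qed

lemma distr_unif_seq_coordinate: "distr unif_seq borel (\<lambda>\<omega>. \<omega> i) = unif"
proof -
  have "distr unif_seq unif (\<lambda>\<omega>. \<omega> i) = unif"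
    unfolding unif_seq_def by (rule distr_PiM_component) (auto intro: unif.prob_space_axioms)
  then show ?thesis by (simp cong: distr_cong)
qed

lemma indep_vars_unif_seq: "unif_seq.indep_vars (\<lambda>_. borel) (\<lambda>i \<omega>. \<omega> i) UNIV"
proof -
  have "unif_seq.indep_vars (\<lambda>_. unif) (\<lambda>i \<omega>. \<omega> i) UNIV"
    unfolding unif_seq_def by (rule indep_vars_PiM_coordinates) (auto intro: unif.prob_space_axioms)
  then show ?thesis
    by (rule unif_seq.indep_vars_compose2[where Y = "\<lambda>_ u. u"]) (simp add: measurable_ident_sets)
qed

lemma distributed_unif_seq_coordinate:
  "distributed unif_seq lborel (\<lambda>\<omega>. \<omega> i) (\<lambda>u. indicator {0..1} u / measure lborel {0..1::real})"
proof -
  have pdf: "ennreal (indicator {0..1} u / measure lborel {0..1::real})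
      = indicator {0..1} u / emeasure lborel {0..1::real}" for u :: real
    by (simp add: indicator_def)
  have "distr unif_seq lborel (\<lambda>\<omega>. \<omega> i) = distr unif_seq borel (\<lambda>\<omega>. \<omega> i)" by (simp cong: distr_cong)
  also have "\<dots> = density lborel (\<lambda>u. ennreal (indicator {0..1} u / measure lborel {0..1::real}))"
    by (simp only: distr_unif_seq_coordinate unif_def uniform_measure_def pdf)
  finally show ?thesis by (simp add: distributed_def)
qed

lemma iid_centered_unif_seq: "iid_centered_sequence unif_seq (\<lambda>i \<omega>. 1 - 2 * \<omega> (Suc i)) (1 / sqrt 3)"
proof (intro iid_centered_sequence.intro iid_centered_sequence_axioms.intro)
  have moments: "unif_seq.expectation (\<lambda>\<omega>. \<omega> i) = 1 / 2" "unif_seq.variance (\<lambda>\<omega>. \<omega> i) = 1 / 12" for i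
    using unif_seq.uniform_distributed_expectation[OF distributed_unif_seq_coordinate]
      unif_seq.uniform_distributed_variance[OF distributed_unif_seq_coordinate] by simp_all
  have int: "integrable unif_seq (\<lambda>\<omega>. \<omega> i)" for i
  proof (rule unif_seq.integrable_const_bound[where B = 1])
    show "AE \<omega> in unif_seq. norm (\<omega> i) \<le> 1"
      using AE_unif_seq by eventually_elim (simp add: less_imp_le)
  qed simp
  show "unif_seq.indep_vars (\<lambda>_. borel) (\<lambda>i \<omega>. 1 - 2 * \<omega> (Suc i)) UNIV"
    using unif_seq.indep_vars_compose2[OF unif_seq.indep_vars_reindex[OF indep_vars_unif_seq, of Suc UNIV],
        of "\<lambda>_ u. 1 - 2 * u" "\<lambda>_. borel"] by simp
  have "distr unif_seq borel (\<lambda>\<omega>. 1 - 2 * \<omega> (Suc i)) = distr unif borel (\<lambda>u. 1 - 2 * u)" for i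
    unfolding distr_unif_seq_coordinate[of "Suc i", symmetric] by (subst distr_distr) (auto simp: comp_def)
  then show "distr unif_seq borel (\<lambda>\<omega>. 1 - 2 * \<omega> (Suc i)) = distr unif_seq borel (\<lambda>\<omega>. 1 - 2 * \<omega> (Suc j))"
    for i j
    by simp
  show "integrable unif_seq (\<lambda>\<omega>. (1 - 2 * \<omega> (Suc i))\<^sup>2)" for i
  proof (rule unif_seq.integrable_const_bound[where B = 1])
    show "AE \<omega> in unif_seq. norm ((1 - 2 * \<omega> (Suc i))\<^sup>2) \<le> 1"
      using AE_unif_seq
    proof eventually_elim
      case (elim \<omega>)
      then have "\<bar>1 - 2 * \<omega> (Suc i)\<bar> \<le> 1" by (simp add: abs_le_iff less_imp_le)
      then show ?case by (simp add: abs_square_le_1)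
    qed
  qed simp
  show "unif_seq.expectation (\<lambda>\<omega>. 1 - 2 * \<omega> (Suc i)) = 0" for i
    by (simp add: moments int unif_seq.prob_space)
  have "(1 - 2 * \<omega> (Suc i))\<^sup>2 = 4 * (\<omega> (Suc i) - 1 / 2)\<^sup>2" for \<omega> :: "nat \<Rightarrow> real" and i
    by (simp add: power2_eq_square algebra_simps)
  then show "unif_seq.expectation (\<lambda>\<omega>. (1 - 2 * \<omega> (Suc i))\<^sup>2) = (1 / sqrt 3)\<^sup>2" for i
    using moments(2)[of "Suc i"] by (simp add: moments(1) power_divide)
qed (simp_all add: unif_seq.prob_space_axioms)

section \<open>Descents of uniform permutations\<close>

definition unif_perm :: "nat \<Rightarrow> (nat \<Rightarrow> real) \<Rightarrow> nat \<Rightarrow> nat" where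
  "unif_perm n \<omega> = rank_perm n (frac_sums n \<omega>)"

lemma measurable_unif_perm: "unif_perm n \<in> measurable unif_seq (count_space UNIV)"
  unfolding unif_perm_def unif_seq_def
  by (intro measurable_compose[OF measurable_frac_sums measurable_rank_perm[OF unif.prob_space_axioms]])
    simp_all

lemma expectation_unif_perm:
  fixes h :: "(nat \<Rightarrow> nat) \<Rightarrow> real"
  shows "measure_pmf.expectation (pmf_of_set {\<sigma>. \<sigma> permutes {1..n}}) h
    = unif_seq.expectation (\<lambda>\<omega>. h (unif_perm n \<omega>))"
proof -
  let ?Q = "Pi\<^sub>M {1..n} (\<lambda>_. unif)" and ?r = "\<lambda>\<omega>. restrict \<omega> {1..n}"
  have meas: "(\<lambda>v. h (rank_perm n v)) \<in> borel_measurable ?Q"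
    by (rule measurable_compose[OF measurable_rank_perm[OF unif.prob_space_axioms]]) simp_all
  have "?r \<in> measurable unif_seq ?Q"
    unfolding unif_seq_def by (rule measurable_restrict_subset) simp
  moreover have "distr unif_seq ?Q ?r = ?Q"
    unfolding unif_seq_def by (rule unif_product.distr_PiM_restrict_finite) auto
  moreover have "frac_sums n (?r \<omega>) = frac_sums n \<omega>" for \<omega>
    unfolding frac_sums_def by (intro restrict_ext arg_cong[of _ _ frac] sum.cong) auto
  ultimately have "unif_seq.expectation (\<lambda>\<omega>. h (unif_perm n \<omega>)) = (\<integral>u. h (rank_perm n (frac_sums n u)) \<partial>?Q)"
    using integral_distr[of ?r unif_seq ?Q "\<lambda>u. h (rank_perm n (frac_sums n u))"]
      measurable_compose[OF measurable_frac_sums[OF subset_refl] meas] by (simp add: unif_perm_def)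
  also have "\<dots> = (\<integral>v. h (rank_perm n v) \<partial>distr ?Q ?Q (frac_sums n))"
    by (rule integral_distr[symmetric, OF measurable_frac_sums[OF subset_refl] meas])
  also have "\<dots> = measure_pmf.expectation (pmf_of_set {\<sigma>. \<sigma> permutes {1..n}}) h"
    unfolding distr_frac_sums
    by (rule expectation_rank_perm[OF unif.prob_space_axioms]) (simp_all add: emeasure_unif_singleton)
  finally show ?thesis ..
qed

lemma step_unif_perm:
  assumes i: "i < n" and \<omega>: "0 \<le> \<omega> (Suc (Suc i))" "\<omega> (Suc (Suc i)) < 1"
  shows "step (unif_perm (Suc n) \<omega>) (Suc i)
    = 1 - 2 * (real_of_int \<lfloor>\<Sum>j=1..Suc (Suc i). \<omega> j\<rfloor> - real_of_int \<lfloor>\<Sum>j=1..Suc i. \<omega> j\<rfloor>)"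
proof -
  let ?s = "\<Sum>j=1..Suc i. \<omega> j" and ?u = "\<omega> (Suc (Suc i))"
  have sum: "(\<Sum>j=1..Suc (Suc i). \<omega> j) = ?s + ?u" by simp
  have "is_descent (unif_perm (Suc n) \<omega>) (Suc i) \<longleftrightarrow> frac (?s + ?u) < frac ?s"
    unfolding is_descent_def unif_perm_def using i
    by (subst rank_perm_less_iff) (simp_all add: frac_sums_def sum)
  moreover have "\<lfloor>?s + ?u\<rfloor> = \<lfloor>?s\<rfloor> \<or> \<lfloor>?s + ?u\<rfloor> = \<lfloor>?s\<rfloor> + 1" using \<omega> by linarith
  ultimately show ?thesis
    unfolding step_def sum frac_def using \<omega> by auto
qed

lemma sum_step_unif_perm:
  assumes \<omega>: "\<And>i. 0 \<le> \<omega> i \<and> \<omega> i < 1" and k: "k \<le> n"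
  shows "(\<Sum>i<k. step (unif_perm (Suc n) \<omega>) (Suc i)) = real k - 2 * real_of_int \<lfloor>\<Sum>j=1..Suc k. \<omega> j\<rfloor>"
proof -
  define f where "f i = real_of_int \<lfloor>\<Sum>j=1..Suc i. \<omega> j\<rfloor>" for i
  have "(\<Sum>i<k. step (unif_perm (Suc n) \<omega>) (Suc i)) = (\<Sum>i<k. 1 - 2 * (f (Suc i) - f i))"
    using k \<omega> unfolding f_def by (intro sum.cong refl step_unif_perm) auto
  also have "\<dots> = real k - 2 * (\<Sum>i<k. f (Suc i) - f i)"
    by (simp add: sum_subtractf sum_distrib_left)
  also have "\<dots> = real k - 2 * (f k - f 0)"
    by (simp only: sum_lessThan_telescope)
  also have "f 0 = 0" using \<omega>[of 1] by (simp add: f_def floor_eq_iff)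
  finally show ?thesis by (simp only: f_def diff_0_right)
qed

lemma abs_sum_step_diff_walk_le:
  assumes \<omega>: "\<And>i. 0 \<le> \<omega> i \<and> \<omega> i < 1" and k: "k \<le> n"
  shows "\<bar>(\<Sum>i<k. step (unif_perm (Suc n) \<omega>) (Suc i)) - (\<Sum>i<k. 1 - 2 * \<omega> (Suc i))\<bar> \<le> 2"
proof -
  let ?s = "\<Sum>j=1..k. \<omega> j"
  have walk: "(\<Sum>i<k. 1 - 2 * \<omega> (Suc i)) = real k - 2 * ?s"
    by (simp add: sum_subtractf sum_distrib_left sum.atLeast1_atMost_eq)
  have last: "(\<Sum>j=1..Suc k. \<omega> j) = ?s + \<omega> (Suc k)" by simp
  have "\<bar>?s - real_of_int \<lfloor>?s + \<omega> (Suc k)\<rfloor>\<bar> \<le> 1"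
    using \<omega>[of "Suc k"] by linarith
  then show ?thesis unfolding sum_step_unif_perm[of \<omega>, OF assms] walk last by linarith
qed

lemma f_perm_eq_poly_path:
  "(\<lambda>t. f_perm n \<sigma> (real n * t) / c) = poly_path n (\<lambda>i. step \<sigma> (Suc i) / c)"
proof
  fix t
  have "f_perm n \<sigma> (real n * t) = (\<Sum>i<n. step \<sigma> (Suc i) * max 0 (min 1 (real n * t - real i)))"
    by (simp add: f_perm_def sum.atLeast1_atMost_eq)
  then show "f_perm n \<sigma> (real n * t) / c = poly_path n (\<lambda>i. step \<sigma> (Suc i) / c) t"
    by (simp add: poly_path_def sum_divide_distrib)
qed

lemma sup_dist_descent_path_walk_le:
  assumes "\<And>i. 0 \<le> \<omega> i \<and> \<omega> i < 1"
  shows "sup_dist (rescaled_path n (\<lambda>i. step (unif_perm (Suc n) \<omega>) (Suc i)))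
    (rescaled_path n (\<lambda>i. 1 - 2 * \<omega> (Suc i))) \<le> 2 / sqrt (real n)"
  using abs_sum_step_diff_walk_le[of \<omega>, OF assms]
  by (intro sup_dist_poly_path_le) (simp add: divide_right_mono flip: sum_divide_distrib diff_divide_distrib)

lemma uniformly_close_descent_path_walk:
  assumes \<eta>: "\<eta> > 0" and \<epsilon>: "\<epsilon> > 0"
  shows "\<forall>\<^sub>F n in sequentially. uniformly_close_in_prob unif_seq
    (\<lambda>\<omega>. rescaled_path n (\<lambda>i. step (unif_perm (Suc n) \<omega>) (Suc i)))
    (\<lambda>\<omega>. rescaled_path n (\<lambda>i. 1 - 2 * \<omega> (Suc i))) \<eta> \<epsilon>"
proof -
  obtain A where A: "{\<omega> \<in> space unif_seq. \<not> (\<forall>i. 0 \<le> \<omega> i \<and> \<omega> i < 1)} \<subseteq> A"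
    "A \<in> sets unif_seq" "emeasure unif_seq A = 0"
    using AE_unif_seq by (auto elim: AE_E)
  have "(\<lambda>n. 2 / sqrt (real n)) \<longlonglongrightarrow> 0"
    by (intro tendsto_divide_0[OF tendsto_const] filterlim_at_top_imp_at_infinity
        filterlim_compose[OF sqrt_at_top filterlim_real_sequentially])
  then have "\<forall>\<^sub>F n in sequentially. 2 / sqrt (real n) < \<eta>"
    using \<eta> by (intro order_tendstoD)
  then show ?thesis
  proof eventually_elim
    case (elim n)
    show ?case
      unfolding uniformly_close_in_prob_def
    proof (intro bexI[of _ A] conjI ballI)
      show "unif_seq.prob A \<le> \<epsilon>" using A(3) \<epsilon> by (simp add: measure_def)
      fix \<omega> assume "\<omega> \<in> space unif_seq - A"
      then have "\<And>i. 0 \<le> \<omega> i \<and> \<omega> i < 1" using A(1) by blast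
      from sup_dist_descent_path_walk_le[of \<omega> n, OF this] elim
      show "sup_dist (rescaled_path n (\<lambda>i. step (unif_perm (Suc n) \<omega>) (Suc i)))
        (rescaled_path n (\<lambda>i. 1 - 2 * \<omega> (Suc i))) \<le> \<eta>" by linarith
    qed (rule A(2))
  qed
qed

theorem weak_conv_C01_descent_path:
  assumes B: "standard_BM_01 M B"
  shows "weak_conv_C01 (\<lambda>_. unif_seq)
    (\<lambda>n \<omega>. rescaled_path n (\<lambda>i. step (unif_perm (Suc n) \<omega>) (Suc i)))
    M (\<lambda>\<omega> t. 1 / sqrt 3 * B \<omega> t)"
proof (rule weak_conv_C01_converging_together)
  interpret walk: iid_centered_sequence unif_seq "\<lambda>i \<omega>. 1 - 2 * \<omega> (Suc i)" "1 / sqrt 3"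
    by (rule iid_centered_unif_seq)
  show "weak_conv_C01 (\<lambda>_. unif_seq) (\<lambda>n \<omega>. rescaled_path n (\<lambda>i. 1 - 2 * \<omega> (Suc i)))
      M (\<lambda>\<omega> t. 1 / sqrt 3 * B \<omega> t)"
    by (rule walk.Donsker[OF B])
  have "(\<lambda>\<omega>. step (unif_perm (Suc n) \<omega>) (Suc i)) \<in> borel_measurable unif_seq" for n i
    by (rule measurable_compose[OF measurable_unif_perm]) simp
  then show "random_path_C01 unif_seq
      (\<lambda>\<omega>. rescaled_path n (\<lambda>i. step (unif_perm (Suc n) \<omega>) (Suc i)))" for n
    by (intro random_path_C01_poly_path borel_measurable_divide borel_measurable_const)
  show "random_path_C01 unif_seq (\<lambda>\<omega>. rescaled_path n (\<lambda>i. 1 - 2 * \<omega> (Suc i)))" for n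
    by (intro random_path_C01_poly_path) measurable
qed (rule unif_seq.prob_space_axioms standard_BM_01D(1)[OF B] random_path_C01_scaled_BM[OF B]
    uniformly_close_descent_path_walk; assumption)+

theorem theorem33:
  fixes M :: "'a measure" and B :: "'a \<Rightarrow> real \<Rightarrow> real"
  assumes "standard_BM_01 M B"
  shows "\<forall>F. bounded_continuous_functional_C01 F \<longrightarrow>
    (\<lambda>n. measure_pmf.expectation (pmf_of_set {\<sigma>. \<sigma> permutes {1..n+1}})
            (\<lambda>\<sigma>. F (\<lambda>t. f_perm n \<sigma> (real n * t) / sqrt (real n))))
    \<longlonglongrightarrow> prob_space.expectation M (\<lambda>\<omega>. F (\<lambda>t. B \<omega> t / sqrt 3))"
proof (intro allI impI)
  fix F assume F: "bounded_continuous_functional_C01 F"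
  let ?G = "\<lambda>n \<sigma>. F (rescaled_path n (\<lambda>i. step \<sigma> (Suc i)))"
  have "(\<lambda>n. unif_seq.expectation (\<lambda>\<omega>. ?G n (unif_perm (n + 1) \<omega>))) \<longlonglongrightarrow> (\<integral>\<omega>. F (\<lambda>t. 1 / sqrt 3 * B \<omega> t) \<partial>M)"
    using weak_conv_C01_descent_path[OF assms] F by (simp add: weak_conv_C01_def)
  then show "(\<lambda>n. measure_pmf.expectation (pmf_of_set {\<sigma>. \<sigma> permutes {1..n+1}})
            (\<lambda>\<sigma>. F (\<lambda>t. f_perm n \<sigma> (real n * t) / sqrt (real n))))
    \<longlonglongrightarrow> (\<integral>\<omega>. F (\<lambda>t. B \<omega> t / sqrt 3) \<partial>M)"
    unfolding f_perm_eq_poly_path expectation_unif_perm by simp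
qed

end
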